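(* Surjectivity and injectivity are decidable for additive cellular automata over a finite abelian group. That is, there is an algorithm which, given a finite abelian group $G$, a radius $r\in\mathbb{N}$ and the local rule $\delta:G^{2r+1}\to G$ of an additive cellular automaton $F:G^{\mathbb{Z}}\to G^{\mathbb{Z}}$, decides whether $F$ is surjective; and there is likewise an algorithm which decides whether $F$ is injective.
   Context: $\mathbb{N}=\{0,1,2,\ldots\}$. For a finite set $S$, the configuration space $S^{\mathbb{Z}}$ is the set of maps $c:\mathbb{Z}\to S$, $i\mapsto c_i$. A (one-dimensional) cellular automaton with local rule $\delta:S^{2r+1}\to S$ of radius $r\in\mathbb{N}$ is the map $F:S^{\mathbb{Z}}\to S^{\mathbb{Z}}$, $F(c)_i=\delta(c_{i-r},\ldots,c_{i+r})$. An additive cellular automaton over a finite abelian group $G$ is a cellular automaton $F:G^{\mathbb{Z}}\to G^{\mathbb{Z}}$ that is an endomorphism of the (componentwise) group $G^{\mathbb{Z}}$. Equivalently, its local rule has the form $\delta(x_{-r},\ldots,x_r)=\sum_{i=-r}^r\delta_i(x_i)$ with each $\delta_i$ an endomorphism of $G$. *)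

theory Defs
  imports "HOL-Algebra.Algebra" "HOL-Library.Nat_Bijection"
begin

text \<open>
  The model of computation: Kleene's partial recursive functions, as programs with a big-step
  semantics.
\<close>

datatype recf =
    Zero
  | Succ
  | Proj nat
  | Comp recf "recf list"
  | PrimRec recf recf
  | Mu recf

text \<open>
  \<open>computes p xs y\<close>: on the argument vector \<open>xs\<close> the program \<open>p\<close> halts with result \<open>y\<close>.
  Divergence is the absence of such a \<open>y\<close>; in particular \<open>Mu\<close> requires \<open>f\<close> to halt
  on every value below the least zero.
\<close>

inductive computes :: "recf \<Rightarrow> nat list \<Rightarrow> nat \<Rightarrow> bool" where
  "computes Zero xs 0"
| "computes Succ [x] (Suc x)"
| "i < length xs \<Longrightarrow> computes (Proj i) xs (xs ! i)"
| "list_all2 (\<lambda>g y. computes g xs y) gs ys \<Longrightarrow> computes f ys z \<Longrightarrow> computes (Comp f gs) xs z"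
| "computes f xs y \<Longrightarrow> computes (PrimRec f g) (0 # xs) y"
| "computes (PrimRec f g) (n # xs) y \<Longrightarrow> computes g (n # y # xs) z \<Longrightarrow>
     computes (PrimRec f g) (Suc n # xs) z"
| "computes f (n # xs) 0 \<Longrightarrow> \<forall>m<n. \<exists>y>0. computes f (m # xs) y \<Longrightarrow> computes (Mu f) xs n"

inductive_cases computes_ZeroE: "computes Zero xs y"
inductive_cases computes_SuccE: "computes Succ xs y"
inductive_cases computes_ProjE: "computes (Proj i) xs y"
inductive_cases computes_CompE: "computes (Comp f gs) xs y"
inductive_cases computes_PrimRec0E: "computes (PrimRec f g) (0 # xs) y"
inductive_cases computes_PrimRecSE: "computes (PrimRec f g) (Suc n # xs) y"
inductive_cases computes_MuE: "computes (Mu f) xs y"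

lemma computes_deterministic: "computes p xs y \<Longrightarrow> computes p xs z \<Longrightarrow> y = z"
proof (induction arbitrary: z rule: computes.induct)
  case (4 xs gs ys f y)
  from "4.prems" obtain ys' where ys': "list_all2 (\<lambda>g y. computes g xs y) gs ys'" "computes f ys' z"
    by (rule computes_CompE)
  have "ys = ys'"
    using "4.IH"(1) ys'(1) by (intro nth_equalityI) (auto simp: list_all2_conv_all_nth)
  with "4.IH"(2) ys'(2) show ?case by blast
next
  case (6 f g n xs y w)
  from "6.prems" obtain y' where "computes (PrimRec f g) (n # xs) y'" "computes g (n # y' # xs) z"
    by (rule computes_PrimRecSE)
  with "6.IH" show ?case by blast
next
  case (7 f n xs)
  from "7.prems" have z: "computes f (z # xs) 0" "\<forall>m<z. \<exists>y>0. computes f (m # xs) y"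
    by (auto elim: computes_MuE)
  show ?case
  proof (rule linorder_cases[of n z])
    assume "n < z"
    with z(2) "7.IH"(1) show ?thesis by fastforce
  next
    assume "z < n"
    with z(1) "7.IH"(2) show ?thesis by fastforce
  qed
qed (blast elim: computes_ZeroE computes_SuccE computes_ProjE computes_PrimRec0E)+

text \<open>
  A single program answers \<open>P\<close> correctly on every instance in \<open>I\<close>; instances are presented
  to it through their code numbers.
\<close>

definition decidable_on :: "('x \<Rightarrow> nat) \<Rightarrow> 'x set \<Rightarrow> ('x \<Rightarrow> bool) \<Rightarrow> bool" where
  "decidable_on code I P \<longleftrightarrow> (\<exists>p. \<forall>x\<in>I. computes p [code x] (if P x then 1 else 0))"

definition configs :: "'a set \<Rightarrow> (int \<Rightarrow> 'a) set" where
  "configs S = (UNIV \<rightarrow>\<^sub>E S)"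

definition words :: "nat \<Rightarrow> 'a set \<Rightarrow> 'a list set" where
  "words k S = {w. set w \<subseteq> S \<and> length w = k}"

definition global_map :: "nat \<Rightarrow> ('a list \<Rightarrow> 'a) \<Rightarrow> (int \<Rightarrow> 'a) \<Rightarrow> (int \<Rightarrow> 'a)" where
  "global_map r \<delta> c = (\<lambda>i. \<delta> (map (\<lambda>j. c (i + j)) [- int r..int r]))"

definition ca_surjective :: "'a set \<Rightarrow> nat \<Rightarrow> ('a list \<Rightarrow> 'a) \<Rightarrow> bool" where
  "ca_surjective S r \<delta> \<longleftrightarrow> global_map r \<delta> ` configs S = configs S"

definition ca_injective :: "'a set \<Rightarrow> nat \<Rightarrow> ('a list \<Rightarrow> 'a) \<Rightarrow> bool" where
  "ca_injective S r \<delta> \<longleftrightarrow> inj_on (global_map r \<delta>) (configs S)"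

text \<open>
  The group \<open>G\<^sup>\<int>\<close> is the product group below; its carrier is \<open>configs (carrier G)\<close>.
  HOL-Algebra writes the (abelian) group operation multiplicatively.
\<close>

abbreviation config_group :: "'a monoid \<Rightarrow> (int \<Rightarrow> 'a) monoid" where
  "config_group G \<equiv> product_group UNIV (\<lambda>_. G)"

definition additive_ca :: "'a monoid \<Rightarrow> nat \<Rightarrow> ('a list \<Rightarrow> 'a) \<Rightarrow> bool" where
  "additive_ca G r \<delta> \<longleftrightarrow>
     \<delta> \<in> words (2 * r + 1) (carrier G) \<rightarrow> carrier G \<and>
     global_map r \<delta> \<in> hom (config_group G) (config_group G)"

text \<open>
  To be handed to an algorithm, a finite abelian group is presented by a Cayley table, so its
  elements are numbered \<open>0, \<dots>, n - 1\<close>. Up to isomorphism this covers every finite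
  abelian group.
\<close>

definition finite_abelian_group :: "nat monoid \<Rightarrow> bool" where
  "finite_abelian_group G \<longleftrightarrow> comm_group G \<and> carrier G = {..<order G}"

lemma finite_abelian_group_exhaustive:
  fixes G :: "'a monoid" (structure)
  assumes "comm_group G" and "finite (carrier G)"
  shows "\<exists>H. finite_abelian_group H \<and> G \<cong> H"
proof -
  interpret comm_group G by fact
  obtain h where h: "bij_betw h (carrier G) {..<order G}"
    using ex_bij_betw_finite_nat[OF assms(2)] by (auto simp: order_def atLeast0LessThan)
  define g where "g = inv_into (carrier G) h"
  define H where "H = \<lparr>carrier = {..<order G}, monoid.mult = \<lambda>x y. h (g x \<otimes> g y), one = h \<one>\<rparr>"
  have gc: "g x \<in> carrier G" "h (g x) = x" if "x < order G" for x
    using h that unfolding g_def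
    by (metis bij_betw_def inv_into_into lessThan_iff, metis bij_betw_inv_into_right lessThan_iff)
  have hc: "h x < order G" "g (h x) = x" if "x \<in> carrier G" for x
    using h that unfolding g_def
    by (auto simp: bij_betw_inv_into_left dest: bij_betwE)
  have "comm_group H"
  proof (rule comm_groupI)
    fix x assume x: "x \<in> carrier H"
    show "\<exists>y\<in>carrier H. y \<otimes>\<^bsub>H\<^esub> x = \<one>\<^bsub>H\<^esub>"
      using x gc hc by (intro bexI[of _ "h (inv (g x))"]) (auto simp: H_def)
  qed (use gc hc in \<open>auto simp: H_def m_ac\<close>)
  moreover have "h \<in> iso G H"
    using h hc by (auto simp: iso_def hom_def H_def)
  moreover have "order H = order G" by (simp add: order_def H_def)
  ultimately show ?thesis
    unfolding finite_abelian_group_def is_iso_def by (intro exI[of _ H]) (auto simp: H_def)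
qed

type_synonym ca_instance = "nat monoid \<times> nat \<times> (nat list \<Rightarrow> nat)"

definition additive_ca_instances :: "ca_instance set" where
  "additive_ca_instances = {(G, r, \<delta>). finite_abelian_group G \<and> additive_ca G r \<delta>}"

text \<open>
  The code lists the order of the group, its Cayley table, the radius, and the values of the
  local rule on all words of length \<open>2r + 1\<close> (ordered with the first letter varying fastest).
  It depends on the instance only through this finite data.
\<close>

fun ca_code :: "ca_instance \<Rightarrow> nat" where
  "ca_code (G, r, \<delta>) =
     list_encode
       [order G,
        list_encode (map (\<lambda>(x, y). x \<otimes>\<^bsub>G\<^esub> y) (List.product [0..<order G] [0..<order G])),
        r,
        list_encode (map \<delta> (List.n_lists (2 * r + 1) [0..<order G]))]"

end

theory Submission
  imports Defs
begin

text \<open>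
  Since the global map \<open>F\<close> is a homomorphism, it is injective iff its kernel is trivial. By the
  Garden of Eden theorem it is surjective iff its kernel has no nontrivial configuration of finite
  support: if it has one, its translates make the fibres of the block maps too large for these maps
  to be onto; conversely, compactness turns non-surjectivity into an orphan word, and counting the
  images that avoid it gives two finitely supported configurations with the same image.

  Kernel configurations are paths in a finite graph whose states are the \<open>N ^ (2 * r)\<close> words of
  length \<open>2 * r\<close>. Cutting out cycles bounds the support of the shortest nontrivial finite kernel
  configuration, and pumping cycles extends a sufficiently long finite piece of a kernel
  configuration arbitrarily far, hence, by compactness, to a kernel configuration. Both properties
  thus amount to the absence of words of a computable length satisfying finitely many equations, a
  search that a recursive function can perform on the code.
\<close>

section \<open>Total recursive functions\<close>

definition total_recursive :: "nat \<Rightarrow> (nat list \<Rightarrow> nat) \<Rightarrow> bool" where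
  "total_recursive k F \<longleftrightarrow> (\<exists>p. \<forall>xs. length xs = k \<longrightarrow> computes p xs (F xs))"

text \<open>Resolution with these rules follows the syntax of a term and assembles a program for
  it.\<close>

named_theorems total_recursive_intros

lemma total_recursive_cong:
  assumes "total_recursive k F" "\<And>xs. length xs = k \<Longrightarrow> F xs = G xs"
  shows "total_recursive k G"
  using assms unfolding total_recursive_def by metis

lemma total_recursive_nth: "i < k \<Longrightarrow> total_recursive k (\<lambda>xs. xs ! i)"
  unfolding total_recursive_def by (blast intro: computes.intros(3))

lemma total_recursive_comp:
  assumes "total_recursive (length Gs) F" "\<And>G. G \<in> set Gs \<Longrightarrow> total_recursive k G"
  shows "total_recursive k (\<lambda>xs. F (map (\<lambda>G. G xs) Gs))"
proof -
  obtain f where f: "length ys = length Gs \<Longrightarrow> computes f ys (F ys)" for ys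
    using assms(1) unfolding total_recursive_def by blast
  from assms(2) have "\<forall>G\<in>set Gs. \<exists>g. \<forall>xs. length xs = k \<longrightarrow> computes g xs (G xs)"
    unfolding total_recursive_def by blast
  then obtain g where g: "G \<in> set Gs \<Longrightarrow> length xs = k \<Longrightarrow> computes (g G) xs (G xs)" for G xs
    by metis
  have "computes (Comp f (map g Gs)) xs (F (map (\<lambda>G. G xs) Gs))" if "length xs = k" for xs
    using that by (intro computes.intros(4)[OF _ f]) (auto simp: list_all2_conv_all_nth g)
  then show ?thesis unfolding total_recursive_def by blast
qed

lemma total_recursive_reindex:
  assumes "total_recursive (length js) F" "\<And>j. j \<in> set js \<Longrightarrow> j < k"
  shows "total_recursive k (\<lambda>xs. F (map ((!) xs) js))"
proof -
  have "total_recursive k (\<lambda>xs. F (map (\<lambda>G. G xs) (map (\<lambda>j xs. xs ! j) js)))"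
    by (rule total_recursive_comp) (use assms in \<open>auto intro: total_recursive_nth\<close>)
  then show ?thesis by (simp add: comp_def)
qed

lemma total_recursive_comp1:
  assumes "total_recursive 1 (\<lambda>ys. f (hd ys))" "total_recursive k A"
  shows "total_recursive k (\<lambda>xs. f (A xs))"
  using total_recursive_comp[of "[A]" "\<lambda>ys. f (hd ys)" k] assms by simp

lemma total_recursive_comp2:
  assumes "total_recursive 2 (\<lambda>ys. f (hd ys) (hd (tl ys)))"
    "total_recursive k A" "total_recursive k B"
  shows "total_recursive k (\<lambda>xs. f (A xs) (B xs))"
proof -
  have "total_recursive k (\<lambda>xs. (\<lambda>ys. f (hd ys) (hd (tl ys))) (map (\<lambda>G. G xs) [A, B]))"
    by (rule total_recursive_comp) (use assms in \<open>auto simp: eval_nat_numeral\<close>)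
  then show ?thesis by simp
qed

lemma total_recursive_hd [total_recursive_intros]: "total_recursive (Suc k) (\<lambda>xs. hd xs)"
  by (rule total_recursive_cong[OF total_recursive_nth[of 0]]) (auto simp: length_Suc_conv)

lemma total_recursive_tl:
  assumes "total_recursive k F"
  shows "total_recursive (Suc k) (\<lambda>xs. F (tl xs))"
  by (rule total_recursive_cong[OF total_recursive_reindex[of "[1..<Suc k]" F]])
    (use assms in \<open>auto intro!: arg_cong[of _ _ F] nth_equalityI simp: nth_tl simp del: upt_Suc\<close>)

text \<open>Variables are addressed as de Bruijn indices: a quantifier or a recursion pushes its
  variables onto the front of the vector. Depth four is enough, as the final conditions nest three
  quantifiers over one input.\<close>

lemmas total_recursive_hd_tl [total_recursive_intros] =
  total_recursive_tl[OF total_recursive_hd]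
  total_recursive_tl[OF total_recursive_tl[OF total_recursive_hd]]
  total_recursive_tl[OF total_recursive_tl[OF total_recursive_tl[OF total_recursive_hd]]]

lemma total_recursive_Suc [total_recursive_intros]:
  assumes "total_recursive k A" shows "total_recursive k (\<lambda>xs. Suc (A xs))"
proof (rule total_recursive_comp1[OF _ assms])
  show "total_recursive 1 (\<lambda>ys. Suc (hd ys))"
    unfolding total_recursive_def
    by (intro exI[of _ Succ]) (auto simp: length_Suc_conv intro: computes.intros(2))
qed

lemma total_recursive_const [total_recursive_intros]: "total_recursive k (\<lambda>_. c)"
proof (induction c)
  case 0
  show ?case unfolding total_recursive_def by (blast intro: computes.intros(1))
qed (rule total_recursive_Suc)

lemma total_recursive_rec_nat [total_recursive_intros]:
  assumes N: "total_recursive k N" and A: "total_recursive k A"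
    and H: "total_recursive (Suc (Suc k)) (\<lambda>ys. H (hd ys) (hd (tl ys)) (tl (tl ys)))"
  shows "total_recursive k (\<lambda>xs. rec_nat (A xs) (\<lambda>i a. H i a xs) (N xs))"
proof -
  obtain f where f: "length xs = k \<Longrightarrow> computes f xs (A xs)" for xs
    using A unfolding total_recursive_def by blast
  obtain h where h: "length ys = Suc (Suc k) \<Longrightarrow> computes h ys (H (hd ys) (hd (tl ys)) (tl (tl ys)))" for ys
    using H unfolding total_recursive_def by blast
  have *: "computes (PrimRec f h) (n # xs) (rec_nat (A xs) (\<lambda>i a. H i a xs) n)" if "length xs = k" for n xs
  proof (induction n)
    case 0
    then show ?case using that by (auto intro: computes.intros(5) f)
  next
    case (Suc n)
    then show ?case
      using h[of "n # rec_nat (A xs) (\<lambda>i a. H i a xs) n # xs"] that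
      by (auto intro: computes.intros(6))
  qed
  then have "total_recursive (Suc k) (\<lambda>ys. rec_nat (A (tl ys)) (\<lambda>i a. H i a (tl ys)) (hd ys))"
    unfolding total_recursive_def by (intro exI[of _ "PrimRec f h"]) (auto simp: length_Suc_conv)
  \<comment> \<open>\<open>PrimRec\<close> recurses on the head of its vector; composing with
    \<open>N\<close> followed by all projections puts \<open>N xs\<close> there.\<close>
  then have "total_recursive k (\<lambda>xs. (\<lambda>ys. rec_nat (A (tl ys)) (\<lambda>i a. H i a (tl ys)) (hd ys))
      (map (\<lambda>G. G xs) (N # map (\<lambda>j xs. xs ! j) [0..<k])))"
    by (intro total_recursive_comp) (use N in \<open>auto intro: total_recursive_nth\<close>)
  then show ?thesis
  proof (rule total_recursive_cong)
    fix xs :: "nat list" assume "length xs = k"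
    then have "map ((\<lambda>G. G xs) \<circ> (\<lambda>j xs. xs ! j)) [0..<k] = xs"
      by (auto intro: nth_equalityI)
    then show "(\<lambda>ys. rec_nat (A (tl ys)) (\<lambda>i a. H i a (tl ys)) (hd ys))
      (map (\<lambda>G. G xs) (N # map (\<lambda>j xs. xs ! j) [0..<k])) = rec_nat (A xs) (\<lambda>i a. H i a xs) (N xs)"
      by simp
  qed
qed

section \<open>Arithmetic, connectives and bounded quantifiers\<close>

lemma total_recursive_plus [total_recursive_intros]:
  assumes "total_recursive k A" "total_recursive k B"
  shows "total_recursive k (\<lambda>xs. A xs + B xs)"
proof (rule total_recursive_comp2[OF _ assms, of plus])
  have "(a :: nat) + b = rec_nat a (\<lambda>i c. Suc c) b" for a b by (induction b) auto
  then show "total_recursive 2 (\<lambda>ys. hd ys + hd (tl ys))"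
    unfolding numeral_2_eq_2 by (simp only:) (intro total_recursive_intros)
qed

lemma total_recursive_times [total_recursive_intros]:
  assumes "total_recursive k A" "total_recursive k B"
  shows "total_recursive k (\<lambda>xs. A xs * B xs)"
proof (rule total_recursive_comp2[OF _ assms, of times])
  have "(a :: nat) * b = rec_nat 0 (\<lambda>i c. c + a) b" for a b by (induction b) auto
  then show "total_recursive 2 (\<lambda>ys. hd ys * hd (tl ys))"
    unfolding numeral_2_eq_2 by (simp only:) (intro total_recursive_intros)
qed

lemma total_recursive_power [total_recursive_intros]:
  assumes "total_recursive k A" "total_recursive k B"
  shows "total_recursive k (\<lambda>xs. A xs ^ B xs)"
proof (rule total_recursive_comp2[OF _ assms, of power])
  have "(a :: nat) ^ b = rec_nat 1 (\<lambda>i c. c * a) b" for a b by (induction b) auto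
  then show "total_recursive 2 (\<lambda>ys. hd ys ^ hd (tl ys))"
    unfolding numeral_2_eq_2 by (simp only:) (intro total_recursive_intros)
qed

lemma total_recursive_minus [total_recursive_intros]:
  assumes "total_recursive k A" "total_recursive k B"
  shows "total_recursive k (\<lambda>xs. A xs - B xs)"
proof (rule total_recursive_comp2[OF _ assms, of minus])
  have pred: "(a :: nat) - 1 = rec_nat 0 (\<lambda>i c. i) a" for a by (cases a) auto
  have "(a :: nat) - b = rec_nat a (\<lambda>i c. rec_nat 0 (\<lambda>i c. i) c) b" for a b
    by (induction b) (auto simp: pred[symmetric])
  then show "total_recursive 2 (\<lambda>ys. hd ys - hd (tl ys))"
    unfolding numeral_2_eq_2 by (simp only:) (intro total_recursive_intros)
qed

lemma total_recursive_not [total_recursive_intros]: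
  assumes "total_recursive k (\<lambda>xs. of_bool (P xs))"
  shows "total_recursive k (\<lambda>xs. of_bool (\<not> P xs))"
proof -
  have "total_recursive k (\<lambda>xs. 1 - of_bool (P xs))"
    by (intro total_recursive_intros assms)
  then show ?thesis by (rule total_recursive_cong) simp
qed

lemma total_recursive_conj [total_recursive_intros]:
  assumes "total_recursive k (\<lambda>xs. of_bool (P xs))" "total_recursive k (\<lambda>xs. of_bool (Q xs))"
  shows "total_recursive k (\<lambda>xs. of_bool (P xs \<and> Q xs))"
proof -
  have "total_recursive k (\<lambda>xs. of_bool (P xs) * of_bool (Q xs))"
    by (intro total_recursive_intros assms)
  then show ?thesis by (rule total_recursive_cong) simp
qed

lemma total_recursive_le [total_recursive_intros]:
  assumes "total_recursive k A" "total_recursive k B"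
  shows "total_recursive k (\<lambda>xs. of_bool (A xs \<le> B xs))"
proof -
  have "total_recursive k (\<lambda>xs. 1 - (A xs - B xs))"
    by (intro total_recursive_intros assms)
  then show ?thesis by (rule total_recursive_cong) auto
qed

lemma total_recursive_eq [total_recursive_intros]:
  assumes "total_recursive k A" "total_recursive k B"
  shows "total_recursive k (\<lambda>xs. of_bool (A xs = B xs))"
proof -
  have "total_recursive k (\<lambda>xs. of_bool (A xs \<le> B xs \<and> B xs \<le> A xs))"
    by (intro total_recursive_intros assms)
  then show ?thesis by (rule total_recursive_cong) (simp add: eq_iff)
qed

text \<open>The truth values of the instances are multiplied along a primitive recursion. Its step
  also receives the accumulator, in second position; the reindexing hides it from
  \<open>P\<close>.\<close>

lemma total_recursive_all_less [total_recursive_intros]: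
  assumes B: "total_recursive k B"
    and P: "total_recursive (Suc k) (\<lambda>ys. of_bool (P (hd ys) (tl ys)))"
  shows "total_recursive k (\<lambda>xs. of_bool (\<forall>i<B xs. P i xs))"
proof -
  have js: "map ((!) xs) (0 # [2..<Suc (Suc k)]) = hd xs # tl (tl xs)" if "length xs = Suc (Suc k)" for xs :: "nat list"
    using that by (cases xs; cases "tl xs") (auto intro!: nth_equalityI simp del: upt_Suc)
  have "total_recursive (length (0 # [2..<Suc (Suc k)])) (\<lambda>ys. of_bool (P (hd ys) (tl ys)))"
    using P by (simp del: upt_Suc)
  then have "total_recursive (Suc (Suc k))
      (\<lambda>xs. (\<lambda>ys. of_bool (P (hd ys) (tl ys))) (map ((!) xs) (0 # [2..<Suc (Suc k)])))"
    by (rule total_recursive_reindex) auto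
  then have "total_recursive (Suc (Suc k)) (\<lambda>ys. of_bool (P (hd ys) (tl (tl ys))))"
    by (rule total_recursive_cong) (simp only: js list.sel)
  then have "total_recursive k (\<lambda>xs. rec_nat 1 (\<lambda>i a. a * of_bool (P i xs)) (B xs))"
    by (intro total_recursive_intros B)
  moreover have "rec_nat 1 (\<lambda>i a. a * of_bool (P i xs)) n = (of_bool (\<forall>i<n. P i xs) :: nat)" for n xs
    by (induction n) (auto simp: less_Suc_eq)
  ultimately show ?thesis by simp
qed

lemma total_recursive_ex_less [total_recursive_intros]:
  assumes "total_recursive k B"
    and "total_recursive (Suc k) (\<lambda>ys. of_bool (P (hd ys) (tl ys)))"
  shows "total_recursive k (\<lambda>xs. of_bool (\<exists>i<B xs. P i xs))"
proof -
  have "total_recursive k (\<lambda>xs. of_bool (\<not> (\<forall>i<B xs. \<not> P i xs)))"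
    by (intro total_recursive_intros assms)
  then show ?thesis by simp
qed

section \<open>Unbounded search, division, and decoding of pairs and lists\<close>

lemma total_recursive_Least:
  assumes P: "total_recursive (Suc k) (\<lambda>ys. of_bool (P (hd ys) (tl ys)))"
    and ex: "\<And>xs. \<exists>n. P n xs"
  shows "total_recursive k (\<lambda>xs. LEAST n. P n xs)"
proof -
  \<comment> \<open>\<open>Mu\<close> searches for a zero, so its program computes the negated
    predicate; \<open>ex\<close> makes the search halt on every vector.\<close>
  have "total_recursive (Suc k) (\<lambda>ys. of_bool (\<not> P (hd ys) (tl ys)))"
    by (intro total_recursive_intros P)
  then obtain p where p: "length ys = Suc k \<Longrightarrow> computes p ys (of_bool (\<not> P (hd ys) (tl ys)))" for ys
    unfolding total_recursive_def by blast
  have "computes (Mu p) xs (LEAST n. P n xs)" if xs: "length xs = k" for xs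
  proof (rule computes.intros(7))
    show "computes p ((LEAST n. P n xs) # xs) 0"
      using p[of "(LEAST n. P n xs) # xs"] LeastI_ex[OF ex, of xs] xs by simp
    show "\<forall>m<LEAST n. P n xs. \<exists>y>0. computes p (m # xs) y"
    proof (intro allI impI)
      fix m assume "m < (LEAST n. P n xs)"
      then have "\<not> P m xs" by (rule not_less_Least)
      then have "computes p (m # xs) 1" using p[of "m # xs"] xs by simp
      then show "\<exists>y>0. computes p (m # xs) y" by (intro exI[of _ 1]) simp
    qed
  qed
  then show ?thesis unfolding total_recursive_def by blast
qed

text \<open>The disjunct \<open>b = 0\<close> stops the search at 0, the value of
  \<open>a div 0\<close>; otherwise the quotient is the least \<open>q\<close> with
  \<open>a < b * (q + 1)\<close>.\<close>

lemma div_eq_Least: "(a :: nat) div b = (LEAST q. b = 0 \<or> Suc a \<le> b * Suc q)"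
proof (cases "b = 0")
  case False
  then have "a < b * Suc (a div b)" by (simp add: dividend_less_times_div)
  then show ?thesis
    using False by (intro Least_equality[symmetric])
      (auto simp: Suc_le_eq less_mult_imp_div_less mult.commute
        simp del: mult_Suc mult_Suc_right simp flip: less_Suc_eq_le)
qed simp

lemma total_recursive_div [total_recursive_intros]:
  assumes "total_recursive k A" "total_recursive k B"
  shows "total_recursive k (\<lambda>xs. A xs div B xs)"
proof (rule total_recursive_comp2[OF _ assms, of "(div)"])
  \<comment> \<open>The disjunction is expressed by negation and conjunction, the connectives that
    the collected rules cover.\<close>
  have "total_recursive 2 (\<lambda>ys. LEAST q. \<not> (hd (tl ys) \<noteq> 0 \<and> \<not> Suc (hd ys) \<le> hd (tl ys) * Suc q))"
    unfolding numeral_2_eq_2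
  proof (rule total_recursive_Least)
    fix ys :: "nat list"
    have "hd (tl ys) = 0 \<or> Suc (hd ys) \<le> hd (tl ys) * Suc (hd ys)"
      by (cases "hd (tl ys)") auto
    then show "\<exists>q. \<not> (hd (tl ys) \<noteq> 0 \<and> \<not> Suc (hd ys) \<le> hd (tl ys) * Suc q)"
      by blast
  qed (intro total_recursive_intros)
  then show "total_recursive 2 (\<lambda>ys. hd ys div hd (tl ys))"
    by (simp only: div_eq_Least de_Morgan_conj not_not)
qed

lemma total_recursive_mod [total_recursive_intros]:
  assumes "total_recursive k A" "total_recursive k B"
  shows "total_recursive k (\<lambda>xs. A xs mod B xs)"
  unfolding modulo_nat_def by (intro total_recursive_intros assms)

lemma total_recursive_prod_encode [total_recursive_intros]:
  assumes "total_recursive k A" "total_recursive k B"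
  shows "total_recursive k (\<lambda>xs. prod_encode (A xs, B xs))"
  unfolding prod_encode_def prod.case triangle_def by (intro total_recursive_intros assms)

text \<open>Injectivity of \<open>prod_encode\<close> leaves one candidate, and a component never
  exceeds the code, which bounds the inner search.\<close>

lemma fst_prod_decode_eq_Least: "fst (prod_decode z) = (LEAST m. \<exists>n<Suc z. prod_encode (m, n) = z)"
  by (rule Least_equality[symmetric])
    (auto intro!: exI[of _ "snd (prod_decode z)"] simp: less_Suc_eq_le,
     metis le_prod_encode_2 prod.collapse prod_decode_inverse)

lemma snd_prod_decode_eq_Least: "snd (prod_decode z) = (LEAST n. \<exists>m<Suc z. prod_encode (m, n) = z)"
  by (rule Least_equality[symmetric])
    (auto intro!: exI[of _ "fst (prod_decode z)"] simp: less_Suc_eq_le,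
     metis le_prod_encode_1 prod.collapse prod_decode_inverse)

lemma total_recursive_fst_prod_decode [total_recursive_intros]:
  assumes "total_recursive k A"
  shows "total_recursive k (\<lambda>xs. fst (prod_decode (A xs)))"
proof (rule total_recursive_comp1[OF _ assms])
  show "total_recursive 1 (\<lambda>ys. fst (prod_decode (hd ys)))"
    unfolding fst_prod_decode_eq_Least One_nat_def
  proof (rule total_recursive_Least)
    show "\<exists>m n. n < Suc (hd ys) \<and> prod_encode (m, n) = hd ys" for ys :: "nat list"
      by (metis le_imp_less_Suc le_prod_encode_2 prod.collapse prod_decode_inverse)
  qed (intro total_recursive_intros)
qed

lemma total_recursive_snd_prod_decode [total_recursive_intros]:
  assumes "total_recursive k A"
  shows "total_recursive k (\<lambda>xs. snd (prod_decode (A xs)))"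
proof (rule total_recursive_comp1[OF _ assms])
  show "total_recursive 1 (\<lambda>ys. snd (prod_decode (hd ys)))"
    unfolding snd_prod_decode_eq_Least One_nat_def
  proof (rule total_recursive_Least)
    show "\<exists>n m. m < Suc (hd ys) \<and> prod_encode (m, n) = hd ys" for ys :: "nat list"
      by (metis le_imp_less_Suc le_prod_encode_1 prod.collapse prod_decode_inverse)
  qed (intro total_recursive_intros)
qed

text \<open>
  The head and the tail of the nonempty list coded by \<open>c\<close> are the two components of
  \<open>prod_decode (c - 1)\<close>.
\<close>

definition code_nth :: "nat \<Rightarrow> nat \<Rightarrow> nat" where
  "code_nth c i = fst (prod_decode (rec_nat c (\<lambda>_ d. snd (prod_decode (d - 1))) i - 1))"

lemma total_recursive_code_nth [total_recursive_intros]: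
  assumes "total_recursive k A" "total_recursive k B"
  shows "total_recursive k (\<lambda>xs. code_nth (A xs) (B xs))"
proof (rule total_recursive_comp2[OF _ assms, of code_nth])
  show "total_recursive 2 (\<lambda>ys. code_nth (hd ys) (hd (tl ys)))"
    unfolding code_nth_def numeral_2_eq_2 by (intro total_recursive_intros)
qed

lemma code_nth_list_encode:
  assumes "i < length l"
  shows "code_nth (list_encode l) i = l ! i"
proof -
  have "rec_nat (list_encode l) (\<lambda>_ d. snd (prod_decode (d - 1))) i = list_encode (drop i l)"
    using assms by (induction i) (auto simp flip: Cons_nth_drop_Suc)
  with assms show ?thesis by (auto simp: code_nth_def simp flip: Cons_nth_drop_Suc)
qed

lemma decidable_on_if_total_recursive:
  assumes "total_recursive 1 (\<lambda>xs. of_bool (Q (hd xs)))"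
    and "\<And>x. x \<in> I \<Longrightarrow> P x \<longleftrightarrow> Q (code x)"
  shows "decidable_on code I P"
proof -
  obtain p where "length xs = 1 \<Longrightarrow> computes p xs (of_bool (Q (hd xs)))" for xs
    using assms(1) unfolding total_recursive_def by blast
  then have "computes p [code x] (if P x then 1 else 0)" if "x \<in> I" for x
    using assms(2)[OF that] by (metis length_Cons list.size(3) One_nat_def list.sel(1) of_bool_def)
  then show ?thesis unfolding decidable_on_def by blast
qed

section \<open>Kernels of additive cellular automata\<close>

lemma configs_iff: "c \<in> configs S \<longleftrightarrow> (\<forall>i. c i \<in> S)"
  by (auto simp: configs_def)

text \<open>Sequential compactness, stated as the existence of a cluster point. The pigeonhole
  principle yields nested infinite index sets \<open>A n\<close> whose configurations agree on
  \<open>[-n, n]\<close>, and the limit is read off diagonally.\<close>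

lemma limit_config:
  fixes x :: "nat \<Rightarrow> int \<Rightarrow> 'a"
  assumes S: "finite S" and x: "\<And>n. x n \<in> configs S"
  shows "\<exists>c\<in>configs S. \<forall>n. \<exists>m\<ge>n. \<forall>i. \<bar>i\<bar> \<le> int n \<longrightarrow> c i = x m i"
proof -
  define Q where "Q n A \<longleftrightarrow> infinite A \<and> (\<forall>m\<in>A. \<forall>m'\<in>A. \<forall>i. \<bar>i\<bar> \<le> int n \<longrightarrow> x m i = x m' i)" for n A
  have refine: "\<exists>B\<subseteq>A. Q n B" if A: "infinite A" for n A
  proof -
    define f where "f m = map (x m) [- int n..int n]" for m
    have "f ` A \<subseteq> {w. set w \<subseteq> S \<and> length w = length [- int n..int n]}"
      using x by (auto simp: f_def configs_iff)
    then have "finite (f ` A)" using finite_lists_length_eq[OF S] by (rule finite_subset)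
    then obtain a where "infinite {a' \<in> A. f a' = f a}"
      using pigeonhole_infinite[OF A, of f] by auto
    moreover have "x m i = x m' i" if "f m = f a" "f m' = f a" "\<bar>i\<bar> \<le> int n" for m m' i
    proof -
      have "i \<in> set [- int n..int n]" using that(3) by auto
      with that(1,2) show ?thesis unfolding f_def map_eq_conv by metis
    qed
    ultimately have "Q n {a' \<in> A. f a' = f a}" unfolding Q_def by blast
    then show ?thesis by (intro exI[of _ "{a' \<in> A. f a' = f a}"] conjI) auto
  qed
  have "\<exists>A. \<forall>n. Q n (A n) \<and> A (Suc n) \<subseteq> A n"
  proof (rule dependent_nat_choice)
    show "\<exists>A. Q 0 A" using refine[of UNIV 0] by auto
    show "\<exists>B. Q (Suc n) B \<and> B \<subseteq> A" if "Q n A" for A n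
      using refine[of A "Suc n"] that by (auto simp: Q_def)
  qed
  then obtain A where A: "\<And>n. Q n (A n)" "\<And>n. A (Suc n) \<subseteq> A n" by blast
  have inf: "infinite (A n)" for n using A(1) unfolding Q_def by blast
  have agree: "x m i = x m' i" if "m \<in> A n" "m' \<in> A n" "\<bar>i\<bar> \<le> int n" for m m' i n
    using A(1)[of n] that unfolding Q_def by blast
  have mono: "A n \<subseteq> A m" if "m \<le> n" for m n
    using lift_Suc_antimono_le[of A, OF A(2) that] .
  define c where "c i = x (SOME m. m \<in> A (nat \<bar>i\<bar>)) i" for i
  have c: "c i = x m i" if "m \<in> A (nat \<bar>i\<bar>)" for m i
    unfolding c_def by (rule agree[OF someI[of "\<lambda>m. m \<in> A (nat \<bar>i\<bar>)", OF that] that]) simp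
  have "\<exists>m\<ge>n. \<forall>i. \<bar>i\<bar> \<le> int n \<longrightarrow> c i = x m i" for n
  proof -
    from inf[of n] obtain m where m: "m \<ge> n" "m \<in> A n"
      by (auto simp: infinite_nat_iff_unbounded_le)
    have "c i = x m i" if "\<bar>i\<bar> \<le> int n" for i
    proof (rule c)
      have "nat \<bar>i\<bar> \<le> n" using that by linarith
      with mono m(2) show "m \<in> A (nat \<bar>i\<bar>)" by blast
    qed
    with m(1) show ?thesis by blast
  qed
  moreover have "c \<in> configs S" using x by (auto simp: configs_iff c_def)
  ultimately show ?thesis by blast
qed

text \<open>Only the window of radius \<open>r\<close> around \<open>p\<close> enters the
  computation. With the offset \<open>k\<close>, one fact covers locality (\<open>k = 0\<close>) and
  commutation with shifts.\<close>

lemma global_map_cong: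
  assumes "\<And>t. p - int r \<le> t \<Longrightarrow> t \<le> p + int r \<Longrightarrow> x t = y (t + k)"
  shows "global_map r \<delta> x p = global_map r \<delta> y (p + k)"
  unfolding global_map_def
proof (intro arg_cong[of _ _ \<delta>] map_cong refl)
  fix j assume "j \<in> set [- int r..int r]"
  then have "x (p + j) = y (p + j + k)" by (intro assms) auto
  then show "x (p + j) = y (p + k + j)" by (simp add: add_ac)
qed

lemma global_map_shift: "global_map r \<delta> (\<lambda>t. x (t + k)) p = global_map r \<delta> x (p + k)"
  by (rule global_map_cong) simp

text \<open>A window of \<open>2 * r + 1\<close> cells lies either below \<open>a + 2 * r\<close>,
  where the splice equals \<open>x\<close>, or from \<open>a\<close> on, where it equals
  \<open>y\<close>. Thus words of length \<open>2 * r\<close> act as states.\<close>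

lemma global_map_splice:
  assumes "\<And>t. a \<le> t \<Longrightarrow> t < a + 2 * int r \<Longrightarrow> x t = y t"
  shows "global_map r \<delta> (\<lambda>t. if t < a then x t else y t) p =
    (if p < a + int r then global_map r \<delta> x p else global_map r \<delta> y p)"
proof (cases "p < a + int r")
  case True
  have "global_map r \<delta> (\<lambda>t. if t < a then x t else y t) p = global_map r \<delta> x (p + 0)"
    by (rule global_map_cong) (use True assms in simp)
  with True show ?thesis by simp
next
  case False
  have "global_map r \<delta> (\<lambda>t. if t < a then x t else y t) p = global_map r \<delta> y (p + 0)"
    by (rule global_map_cong) (use False in simp)
  with False show ?thesis by simp
qed

lemma global_map_closed:
  assumes "\<delta> \<in> words (2 * r + 1) S \<rightarrow> S" "x \<in> configs S"
  shows "global_map r \<delta> x \<in> configs S"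
  unfolding configs_iff global_map_def
  by (intro allI funcset_mem[OF assms(1)]) (use assms(2) in \<open>auto simp: words_def configs_iff\<close>)

text \<open>Compactness leaves only orphan words to be excluded: preimages of ever longer central
  segments of \<open>c\<close> cluster at a preimage of \<open>c\<close>.\<close>

lemma ca_surjectiveI:
  assumes S: "finite S" and \<delta>: "\<delta> \<in> words (2 * r + 1) S \<rightarrow> S"
    and pre: "\<And>k w. w \<in> words k S \<Longrightarrow> \<exists>x\<in>configs S. map (\<lambda>i. global_map r \<delta> x (int i)) [0..<k] = w"
  shows "ca_surjective S r \<delta>"
  unfolding ca_surjective_def
proof (rule antisym)
  show "global_map r \<delta> ` configs S \<subseteq> configs S" using global_map_closed[OF \<delta>] by blast
  show "configs S \<subseteq> global_map r \<delta> ` configs S"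
  proof
    fix c assume c: "c \<in> configs S"
    have "\<exists>x\<in>configs S. \<forall>p. \<bar>p\<bar> \<le> int n \<longrightarrow> global_map r \<delta> x p = c p" for n
    proof -
      have "map (\<lambda>i. c (int i - int n)) [0..<2 * n + 1] \<in> words (2 * n + 1) S"
        using c by (auto simp: words_def configs_iff)
      then obtain x where x: "x \<in> configs S"
        and eq: "map (\<lambda>i. global_map r \<delta> x (int i)) [0..<2 * n + 1] = map (\<lambda>i. c (int i - int n)) [0..<2 * n + 1]"
        using pre by blast
      have "global_map r \<delta> (\<lambda>t. x (t + int n)) p = c p" if p: "\<bar>p\<bar> \<le> int n" for p
      proof -
        have "nat (p + int n) \<in> set [0..<2 * n + 1]" using p by auto
        then have "global_map r \<delta> x (int (nat (p + int n))) = c (int (nat (p + int n)) - int n)"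
          using eq unfolding map_eq_conv by blast
        moreover have "int (nat (p + int n)) = p + int n" using p by linarith
        ultimately show ?thesis by (simp only: global_map_shift add_diff_cancel_right')
      qed
      then show ?thesis using x by (intro bexI[of _ "\<lambda>t. x (t + int n)"]) (auto simp: configs_iff)
    qed
    then obtain Y where Y: "\<And>n. Y n \<in> configs S"
      "\<And>n p. \<bar>p\<bar> \<le> int n \<Longrightarrow> global_map r \<delta> (Y n) p = c p"
      by metis
    obtain x where x: "x \<in> configs S" and
      lim: "\<And>n. \<exists>m\<ge>n. \<forall>i. \<bar>i\<bar> \<le> int n \<longrightarrow> x i = Y m i"
      using limit_config[of S Y, OF S Y(1)] by blast
    have "global_map r \<delta> x p = c p" for p
    proof -
      obtain m where m: "m \<ge> nat \<bar>p\<bar> + r" "\<And>i. \<bar>i\<bar> \<le> int (nat \<bar>p\<bar> + r) \<Longrightarrow> x i = Y m i"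
        using lim by metis
      have "global_map r \<delta> x p = global_map r \<delta> (Y m) (p + 0)"
        by (rule global_map_cong) (simp add: m(2))
      with Y(2)[of p m] m(1) show ?thesis by simp
    qed
    with x show "c \<in> global_map r \<delta> ` configs S" by (auto intro!: image_eqI[of _ _ x])
  qed
qed

text \<open>Pigeonhole: the interval offers \<open>card S ^ k + 1\<close> starting positions for at
  most \<open>card S ^ k\<close> words of length \<open>k\<close>.\<close>

lemma config_state_repeats:
  fixes c :: "int \<Rightarrow> 'a"
  assumes S: "finite S" and c: "c \<in> configs S"
  obtains i j where "a \<le> i" "i < j" "j \<le> a + int (card S ^ k)"
    "\<forall>t. i \<le> t \<longrightarrow> t < i + int k \<longrightarrow> c (t + (j - i)) = c t"
proof -
  define f where "f i = map (\<lambda>l. c (i + int l)) [0..<k]" for i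
  let ?I = "{a..a + int (card S ^ k)}"
  have "f ` ?I \<subseteq> {w. set w \<subseteq> S \<and> length w = k}"
    using c by (auto simp: f_def configs_iff)
  then have "card (f ` ?I) \<le> card S ^ k"
    unfolding card_lists_length_eq[OF S, symmetric]
    by (intro card_mono finite_lists_length_eq S)
  then have "\<not> inj_on f ?I"
    by (intro pigeonhole) (simp add: nat_add_distrib nat_power_eq)
  then obtain i j where ij: "i \<in> ?I" "j \<in> ?I" "i < j" "f i = f j"
    by (metis inj_onI linorder_neqE)
  have "c (t + (j - i)) = c t" if "i \<le> t" "t < i + int k" for t
  proof -
    have "nat (t - i) \<in> set [0..<k]" using that by auto
    with ij(4) have "c (i + int (nat (t - i))) = c (j + int (nat (t - i)))"
      unfolding f_def map_eq_conv by blast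
    with that show ?thesis by (simp add: algebra_simps)
  qed
  then show thesis
    using ij(1,2) by (intro that[OF _ ij(3)]) auto
qed

text \<open>The ratio \<open>((p + 1) / p) ^ j\<close> is unbounded by Bernoulli's inequality, used
  here multiplied out so as to stay in the natural numbers. In the counting argument,
  \<open>p\<close> will be the number of words other than an orphan.\<close>

lemma power_eventually_dominates:
  fixes p Q m :: nat
  obtains j where "j \<ge> m" "p ^ j * Q < Suc p ^ j"
proof
  \<comment> \<open>The summand \<open>p * Q\<close> gives \<open>p * Q < p + j\<close>,
    \<open>m\<close> gives the lower bound, and 1 keeps the exponent positive when
    \<open>p = 0\<close>.\<close>
  define j where "j = p * Q + m + 1"
  show "p * Q + m + 1 \<ge> m" by simp
  have *: "p ^ i * (p + i) \<le> p * Suc p ^ i" for i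
  proof (induction i)
    case (Suc i)
    have "p ^ Suc i * (p + Suc i) \<le> p ^ i * (p + i) * Suc p" by (simp add: algebra_simps)
    also have "\<dots> \<le> p * Suc p ^ i * Suc p" using Suc by (rule mult_le_mono1)
    finally show ?case by (simp add: mult_ac)
  qed simp
  show "p ^ (p * Q + m + 1) * Q < Suc p ^ (p * Q + m + 1)"
  proof (cases "p = 0")
    case False
    have "p * (p ^ j * Q) < p ^ j * (p + j)" using False by (simp add: j_def algebra_simps)
    also have "\<dots> \<le> p * Suc p ^ j" by (rule *)
    finally show ?thesis by (simp add: j_def)
  qed simp
qed

section \<open>Injectivity and the kernel\<close>

locale additive_automaton = comm_group G for G :: "'a monoid" (structure) +
  fixes r :: nat and \<delta> :: "'a list \<Rightarrow> 'a"
  assumes fin: "finite (carrier G)" and add: "additive_ca G r \<delta>"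
begin

abbreviation "F \<equiv> global_map r \<delta>"

abbreviation "C \<equiv> configs (carrier G)"

lemma local_rule: "\<delta> \<in> words (2 * r + 1) (carrier G) \<rightarrow> carrier G"
  using add by (simp add: additive_ca_def)

lemma card_carrier_pos: "card (carrier G) > 0"
  unfolding card_gt_0_iff using fin one_closed by blast

lemma F_closed: "x \<in> C \<Longrightarrow> F x \<in> C"
  by (rule global_map_closed[OF local_rule])

lemma F_mult:
  assumes "x \<in> C" "y \<in> C"
  shows "F (\<lambda>t. x t \<otimes> y t) p = F x p \<otimes> F y p"
proof -
  have "F \<in> hom (config_group G) (config_group G)" using add by (simp add: additive_ca_def)
  then have "F (x \<otimes>\<^bsub>config_group G\<^esub> y) = F x \<otimes>\<^bsub>config_group G\<^esub> F y"
    unfolding hom_def using assms by (simp only: mem_Collect_eq carrier_product_group configs_def)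
  then show ?thesis by (simp add: restrict_UNIV fun_eq_iff)
qed

lemma F_one: "F (\<lambda>_. \<one>) p = \<one>"
proof -
  have "F (\<lambda>_. \<one>) p \<otimes> F (\<lambda>_. \<one>) p = F (\<lambda>_. \<one>) p"
    using F_mult[of "\<lambda>_. \<one>" "\<lambda>_. \<one>" p] by (simp add: configs_iff)
  moreover have "F (\<lambda>_. \<one>) p \<in> carrier G" using F_closed[of "\<lambda>_. \<one>"] by (simp add: configs_iff)
  ultimately show ?thesis by (simp add: r_cancel_one')
qed

lemma F_eq_one: "(\<And>t. p - int r \<le> t \<Longrightarrow> t \<le> p + int r \<Longrightarrow> x t = \<one>) \<Longrightarrow> F x p = \<one>"
  using global_map_cong[of p r x "\<lambda>_. \<one>" 0 \<delta>] by (simp add: F_one)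

lemma quotient_in_kernel:
  assumes xy: "x \<in> C" "y \<in> C" and eq: "F x p = F y p"
  shows "F (\<lambda>t. x t \<otimes> inv y t) p = \<one>"
proof -
  let ?z = "\<lambda>t. x t \<otimes> inv y t"
  have z: "?z \<in> C" using xy by (auto simp: configs_iff)
  have "(\<lambda>t. ?z t \<otimes> y t) = x" using xy by (auto simp: configs_iff m_assoc)
  with F_mult[OF z xy(2), of p] have "F ?z p \<otimes> F y p = F y p" using eq by simp
  then show ?thesis using F_closed[OF z] F_closed[OF xy(2)] by (simp add: r_cancel_one' configs_iff)
qed

text \<open>The kernel is shift invariant, so a nontrivial element can be moved to be nontrivial at
  cell 0. Unlike mere nontriviality, this condition passes to cluster points.\<close>

lemma injective_iff_trivial_kernel:
  "ca_injective (carrier G) r \<delta> \<longleftrightarrow> \<not> (\<exists>z\<in>C. z 0 \<noteq> \<one> \<and> (\<forall>p. F z p = \<one>))"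
proof
  assume inj: "ca_injective (carrier G) r \<delta>"
  show "\<not> (\<exists>z\<in>C. z 0 \<noteq> \<one> \<and> (\<forall>p. F z p = \<one>))"
  proof
    assume "\<exists>z\<in>C. z 0 \<noteq> \<one> \<and> (\<forall>p. F z p = \<one>)"
    then obtain z where z: "z \<in> C" "z 0 \<noteq> \<one>" "\<And>p. F z p = \<one>" by blast
    then have "F z = F (\<lambda>_. \<one>)" by (auto simp: F_one)
    moreover have "(\<lambda>_. \<one>) \<in> C" by (simp add: configs_iff)
    ultimately have "z = (\<lambda>_. \<one>)"
      using inj z(1) unfolding ca_injective_def by (blast dest: inj_onD)
    with z(2) show False by simp
  qed
next
  assume triv: "\<not> (\<exists>z\<in>C. z 0 \<noteq> \<one> \<and> (\<forall>p. F z p = \<one>))"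
  show "ca_injective (carrier G) r \<delta>"
    unfolding ca_injective_def
  proof (rule inj_onI, rule ext, rule ccontr)
    fix x y k assume xy: "x \<in> C" "y \<in> C" "F x = F y" and ne: "x k \<noteq> y k"
    let ?z = "\<lambda>t. x t \<otimes> inv y t"
    have "F (\<lambda>t. ?z (t + k)) p = \<one>" for p
      unfolding global_map_shift[of r \<delta> ?z] using xy by (intro quotient_in_kernel) auto
    moreover have "?z (0 + k) \<noteq> \<one>" using xy(1,2) ne by (simp add: configs_iff inv_solve_right')
    moreover have "(\<lambda>t. ?z (t + k)) \<in> C" using xy by (auto simp: configs_iff)
    ultimately have "\<exists>z\<in>C. z 0 \<noteq> \<one> \<and> (\<forall>p. F z p = \<one>)"
      by (intro bexI[of _ "\<lambda>t. ?z (t + k)"] conjI allI)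
    with triv show False by contradiction
  qed
qed

text \<open>
  Pumping: if the states at \<open>i < j\<close> agree, repeating the segment between them lengthens the
  interval on which the image vanishes.
\<close>

lemma extend_kernel_right:
  assumes c: "c \<in> C" "c 0 \<noteq> \<one>" and a: "a \<ge> 0" and b: "b \<ge> int (card (carrier G) ^ (2 * r)) + int r"
    and ker: "\<And>p. - a \<le> p \<Longrightarrow> p \<le> b \<Longrightarrow> F c p = \<one>"
  shows "\<exists>z\<in>C. z 0 \<noteq> \<one> \<and> (\<forall>p. - a \<le> p \<longrightarrow> p \<le> b + 1 \<longrightarrow> F z p = \<one>)"
proof -
  obtain i j where ij: "1 \<le> i" "i < j" "j \<le> 1 + int (card (carrier G) ^ (2 * r))"
    "\<forall>t. i \<le> t \<longrightarrow> t < i + int (2 * r) \<longrightarrow> c (t + (j - i)) = c t"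
    by (rule config_state_repeats[OF fin c(1), of 1 "2 * r"])
  \<comment> \<open>The cells from \<open>i\<close> on move \<open>j - i\<close> places to the
    right, so the segment from \<open>i\<close> to \<open>j\<close> appears twice. Cell 0 is kept
    since \<open>j > 0\<close>, and \<open>j + r - 1 \<le> b\<close> puts the unmoved equations
    inside the given interval.\<close>
  let ?z = "\<lambda>t. if t < j then c t else c (t + (i - j))"
  have "c t = c (t + (i - j))" if "j \<le> t" "t < j + 2 * int r" for t
    using ij(4)[rule_format, of "t + (i - j)"] that by simp
  from global_map_splice[of j r c "\<lambda>t. c (t + (i - j))" \<delta>, OF this]
  have F: "F ?z p = (if p < j + int r then F c p else F c (p + (i - j)))" for p
    by (simp only: global_map_shift)
  show ?thesis
    using c ij(1-3) a b by (intro bexI[of _ ?z]) (auto simp: F configs_iff intro!: ker)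
qed

lemma extend_kernel_left:
  assumes c: "c \<in> C" "c 0 \<noteq> \<one>" and a: "a \<ge> int (card (carrier G) ^ (2 * r))" and b: "b \<ge> int r"
    and ker: "\<And>p. - a \<le> p \<Longrightarrow> p \<le> b \<Longrightarrow> F c p = \<one>"
  shows "\<exists>z\<in>C. z 0 \<noteq> \<one> \<and> (\<forall>p. - (a + 1) \<le> p \<longrightarrow> p \<le> b \<longrightarrow> F z p = \<one>)"
proof -
  \<comment> \<open>Both states start in \<open>[-K, 0]\<close>, where
    \<open>K = card (carrier G) ^ (2 * r)\<close>. Hence \<open>i < 0\<close>, and cell 0 lies in
    the part that is kept.\<close>
  obtain i j where ij: "- int (card (carrier G) ^ (2 * r)) \<le> i" "i < j"
    "j \<le> - int (card (carrier G) ^ (2 * r)) + int (card (carrier G) ^ (2 * r))"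
    "\<forall>t. i \<le> t \<longrightarrow> t < i + int (2 * r) \<longrightarrow> c (t + (j - i)) = c t"
    by (rule config_state_repeats[OF fin c(1), of "- int (card (carrier G) ^ (2 * r))" "2 * r"])
  let ?z = "\<lambda>t. if t < i then c (t + (j - i)) else c t"
  have "c (t + (j - i)) = c t" if "i \<le> t" "t < i + 2 * int r" for t
    using ij(4) that by simp
  from global_map_splice[of i r "\<lambda>t. c (t + (j - i))" c \<delta>, OF this]
  have F: "F ?z p = (if p < i + int r then F c (p + (j - i)) else F c p)" for p
    by (simp only: global_map_shift)
  show ?thesis
    using c ij(1-3) a b by (intro bexI[of _ ?z]) (auto simp: F configs_iff intro!: ker)
qed

text \<open>At this radius both extension steps apply, so the interval on which the image is trivial
  grows at both ends indefinitely while cell 0 stays nontrivial. A cluster point of the results is a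
  nontrivial kernel configuration.\<close>

lemma injective_iff_bounded:
  "ca_injective (carrier G) r \<delta> \<longleftrightarrow>
    \<not> (\<exists>z\<in>C. z 0 \<noteq> \<one> \<and> (\<forall>p. \<bar>p\<bar> \<le> int (card (carrier G) ^ (2 * r) + r) \<longrightarrow> F z p = \<one>))"
    (is "_ \<longleftrightarrow> \<not> ?bounded")
proof -
  let ?m = "card (carrier G) ^ (2 * r) + r"
  have "\<exists>z\<in>C. z 0 \<noteq> \<one> \<and> (\<forall>p. F z p = \<one>)" if ?bounded
  proof -
    have "\<exists>z\<in>C. z 0 \<noteq> \<one> \<and> (\<forall>p. - int (?m + n) \<le> p \<longrightarrow> p \<le> int (?m + n) \<longrightarrow> F z p = \<one>)" for n
    proof (induction n)
      case 0
      from that obtain z where "z \<in> C" "z 0 \<noteq> \<one>" "\<And>p. \<bar>p\<bar> \<le> int ?m \<Longrightarrow> F z p = \<one>" by blast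
      then show ?case by (intro bexI[of _ z] conjI allI impI) (simp_all add: abs_le_iff)
    next
      case (Suc n)
      then obtain z where z: "z \<in> C" "z 0 \<noteq> \<one>"
        "\<And>p. - int (?m + n) \<le> p \<Longrightarrow> p \<le> int (?m + n) \<Longrightarrow> F z p = \<one>" by blast
      obtain z' where z': "z' \<in> C" "z' 0 \<noteq> \<one>"
        "\<And>p. - int (?m + n) \<le> p \<Longrightarrow> p \<le> int (?m + n) + 1 \<Longrightarrow> F z' p = \<one>"
        using extend_kernel_right[OF z(1,2), of "int (?m + n)" "int (?m + n)"] z(3) by auto
      obtain z'' where "z'' \<in> C" "z'' 0 \<noteq> \<one>"
        "\<And>p. - (int (?m + n) + 1) \<le> p \<Longrightarrow> p \<le> int (?m + n) + 1 \<Longrightarrow> F z'' p = \<one>"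
        using extend_kernel_left[OF z'(1,2), of "int (?m + n)" "int (?m + n) + 1"] z'(3) by auto
      moreover have "int (?m + Suc n) = int (?m + n) + 1" by simp
      ultimately show ?case by metis
    qed
    then obtain Y where Y: "\<And>n. Y n \<in> C" "\<And>n. Y n 0 \<noteq> \<one>"
      "\<And>n p. - int (?m + n) \<le> p \<Longrightarrow> p \<le> int (?m + n) \<Longrightarrow> F (Y n) p = \<one>"
      by metis
    obtain x where x: "x \<in> C" and lim: "\<And>n. \<exists>m\<ge>n. \<forall>i. \<bar>i\<bar> \<le> int n \<longrightarrow> x i = Y m i"
      using limit_config[of "carrier G" Y, OF fin Y(1)] by blast
    have "F x p = \<one>" for p
    proof -
      obtain m where m: "m \<ge> nat \<bar>p\<bar> + r" "\<And>i. \<bar>i\<bar> \<le> int (nat \<bar>p\<bar> + r) \<Longrightarrow> x i = Y m i"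
        using lim by metis
      have "F x p = F (Y m) (p + 0)"
        by (rule global_map_cong) (simp add: m(2))
      moreover have "F (Y m) p = \<one>" by (rule Y(3)) (use m(1) in linarith)+
      ultimately show ?thesis by simp
    qed
    moreover obtain k where "x 0 = Y k 0" using lim[of 0] by auto
    then have "x 0 \<noteq> \<one>" using Y(2)[of k] by simp
    ultimately show ?thesis using x by blast
  qed
  then show ?thesis unfolding injective_iff_trivial_kernel by blast
qed

section \<open>Surjectivity and kernel configurations of finite support\<close>

text \<open>Normal form of a nontrivial kernel configuration of finite support: shifted so that its
  leftmost nontrivial cell is 0.\<close>

definition finite_kernel_config :: "(int \<Rightarrow> 'a) \<Rightarrow> nat \<Rightarrow> bool" where
  "finite_kernel_config z m \<longleftrightarrow>
    z \<in> C \<and> z 0 \<noteq> \<one> \<and> (\<forall>p. F z p = \<one>) \<and> (\<forall>t. t < 0 \<or> int m \<le> t \<longrightarrow> z t = \<one>)"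

text \<open>The segment between two equal states can be cut out. Cell 0 survives because
  \<open>i \<ge> 1\<close>, and the extent drops by \<open>j - i\<close>, so the process
  ends.\<close>

lemma shorten_finite_kernel_config:
  assumes "finite_kernel_config z m"
  shows "\<exists>z. finite_kernel_config z (Suc (card (carrier G) ^ (2 * r)))"
  using assms
proof (induction m arbitrary: z rule: less_induct)
  case (less m)
  show ?case
  proof (cases "m \<le> Suc (card (carrier G) ^ (2 * r))")
    case True
    then have "int m \<le> t" if "int (Suc (card (carrier G) ^ (2 * r))) \<le> t" for t
      using that by linarith
    with less.prems show ?thesis unfolding finite_kernel_config_def by blast
  next
    case False
    have z: "z \<in> C" "z 0 \<noteq> \<one>" "\<And>p. F z p = \<one>" "\<And>t. t < 0 \<or> int m \<le> t \<Longrightarrow> z t = \<one>"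
      using less.prems by (auto simp: finite_kernel_config_def)
    obtain i j where ij: "1 \<le> i" "i < j" "j \<le> 1 + int (card (carrier G) ^ (2 * r))"
      "\<forall>t. i \<le> t \<longrightarrow> t < i + int (2 * r) \<longrightarrow> z (t + (j - i)) = z t"
      by (rule config_state_repeats[OF fin z(1), of 1 "2 * r"])
    let ?z = "\<lambda>t. if t < i then z t else z (t + (j - i))"
    have "z t = z (t + (j - i))" if "i \<le> t" "t < i + 2 * int r" for t
      using ij(4) that by simp
    from global_map_splice[of i r z "\<lambda>t. z (t + (j - i))" \<delta>, OF this]
    have "F ?z p = \<one>" for p
      by (simp only: global_map_shift z(3) if_cancel)
    \<comment> \<open>Therefore every cell from \<open>m - (j - i)\<close> on belongs to the shifted
      part, where it is trivial.\<close>
    moreover have "j \<le> int m" using ij(3) False by linarith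
    ultimately have "finite_kernel_config ?z (nat (int m - (j - i)))"
      using z(1,2,4) ij(1,2) by (auto simp: finite_kernel_config_def configs_iff)
    moreover have "nat (int m - (j - i)) < m" using ij(2) \<open>j \<le> int m\<close> ij(1) by linarith
    ultimately show ?thesis using less.IH by blast
  qed
qed

lemma finite_supported_configs:
  assumes "finite I"
  shows "finite {x \<in> C. \<forall>t. t \<notin> I \<longrightarrow> x t = \<one>}"
    and "card {x \<in> C. \<forall>t. t \<notin> I \<longrightarrow> x t = \<one>} = card (carrier G) ^ card I"
proof -
  let ?H = "{x \<in> C. \<forall>t. t \<notin> I \<longrightarrow> x t = \<one>}"
  have "bij_betw (\<lambda>x. restrict x I) ?H (I \<rightarrow>\<^sub>E carrier G)"
  proof (rule bij_betw_byWitness[where f' = "\<lambda>f t. if t \<in> I then f t else \<one>"])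
  qed (auto simp: configs_iff PiE_iff extensional_def fun_eq_iff)
  moreover have "finite (I \<rightarrow>\<^sub>E carrier G)" "card (I \<rightarrow>\<^sub>E carrier G) = card (carrier G) ^ card I"
    using assms fin by (auto simp: card_PiE intro: finite_PiE)
  ultimately show "finite ?H" "card ?H = card (carrier G) ^ card I"
    by (simp_all add: bij_betw_finite bij_betw_same_card)
qed

text \<open>A block of \<open>n\<close> cells takes \<open>N ^ n\<close> values, and
  \<open>N ^ (n + 2 * r)\<close> configurations are supported on the cells it depends on, so fibres
  have average size \<open>K\<close>. Under surjectivity, multiplying preimages by
  \<open>K + 1\<close> translates of \<open>z\<close> puts \<open>K + 1\<close> elements into each
  fibre.\<close>

lemma not_surjective_if_finite_kernel_config:
  assumes "finite_kernel_config z m"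
  shows "\<not> ca_surjective (carrier G) r \<delta>"
proof
  assume surj: "ca_surjective (carrier G) r \<delta>"
  have z: "z \<in> C" "z 0 \<noteq> \<one>" "\<And>p. F z p = \<one>" "\<And>t. t < 0 \<or> int m \<le> t \<Longrightarrow> z t = \<one>"
    using assms by (auto simp: finite_kernel_config_def)
  define N where "N = card (carrier G)"
  define K where "K = N ^ (2 * r)"
  \<comment> \<open>This length keeps the translates of \<open>z\<close> by \<open>0, ..., K\<close>
    supported in \<open>{0..<n}\<close>.\<close>
  define n where "n = m + K"
  let ?I = "{- int r..<int n + int r}"
  define H where "H = {x \<in> C. \<forall>t. t \<notin> ?I \<longrightarrow> x t = \<one>}"
  let ?W = "{0..<int n} \<rightarrow>\<^sub>E carrier G"
  have "\<exists>x\<in>H. \<forall>p\<in>{0..<int n}. F x p = y p" if y: "y \<in> ?W" for y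
  proof -
    have "(\<lambda>t. if t \<in> {0..<int n} then y t else \<one>) \<in> F ` C"
      using surj y unfolding ca_surjective_def by (auto simp: configs_iff)
    then obtain x where x: "x \<in> C" "(\<lambda>t. if t \<in> {0..<int n} then y t else \<one>) = F x"
      by (rule imageE) blast
    have "F (\<lambda>t. if t \<in> ?I then x t else \<one>) p = y p" if p: "p \<in> {0..<int n}" for p
    proof -
      have "F (\<lambda>t. if t \<in> ?I then x t else \<one>) p = F x (p + 0)"
        by (rule global_map_cong) (use p in auto)
      also have "\<dots> = y p" using fun_cong[OF x(2), of p] p by simp
      finally show ?thesis .
    qed
    then show ?thesis using x(1)
      by (intro bexI[of _ "\<lambda>t. if t \<in> ?I then x t else \<one>"]) (auto simp: H_def configs_iff)
  qed
  then obtain Y where Y: "\<And>y. y \<in> ?W \<Longrightarrow> Y y \<in> H"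
    "\<And>y p. y \<in> ?W \<Longrightarrow> p \<in> {0..<int n} \<Longrightarrow> F (Y y) p = y p"
    by metis
  \<comment> \<open>The translates of \<open>z\<close> are distinct since \<open>z\<close> has finite support; they make every fibre of
    the block map larger than \<open>K\<close>, the ratio of the cardinalities of its domain and codomain.\<close>
  define \<Phi> where "\<Phi> = (\<lambda>(y, k) t. Y y t \<otimes> z (t - int k))"
  have F_\<Phi>: "F (\<Phi> (y, k)) p = y p" if "y \<in> ?W" "p \<in> {0..<int n}" for y k p
  proof -
    have "Y y \<in> C" using Y(1)[OF that(1)] by (simp add: H_def)
    moreover have "(\<lambda>t. z (t + - int k)) \<in> C" using z(1) by (simp add: configs_iff)
    moreover have "y p \<in> carrier G" using that by auto
    ultimately show ?thesis
      using F_mult[of "Y y" "\<lambda>t. z (t + - int k)" p] global_map_shift[of r \<delta> z "- int k" p] Y(2)[OF that] z(3)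
      by (simp add: \<Phi>_def)
  qed
  have "inj_on \<Phi> (?W \<times> {..K})"
  proof (rule inj_onI, clarify)
    fix y k y' k' assume y: "y \<in> ?W" "y' \<in> ?W" and eq: "\<Phi> (y, k) = \<Phi> (y', k')"
    have "y p = y' p" if "p \<in> {0..<int n}" for p
      using F_\<Phi>[OF y(1) that, of k] F_\<Phi>[OF y(2) that, of k'] eq by simp
    then have yy: "y = y'" using y by (intro PiE_ext) auto
    have eqz: "z (t - int k) = z (t - int k')" for t
      using fun_cong[OF eq, of t] Y(1)[OF y(1)] z(1) by (simp add: \<Phi>_def yy H_def configs_iff)
    have "k = k'"
      using eqz[of "int k"] eqz[of "int k'"] z(2) z(4)[of "int k - int k'"] z(4)[of "int k' - int k"]
      by (cases k k' rule: linorder_cases) auto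
    with yy show "y = y' \<and> k = k'" by simp
  qed
  moreover have "\<Phi> ` (?W \<times> {..K}) \<subseteq> H"
  proof (clarify)
    fix y k assume yk: "y \<in> ?W" "k \<le> K"
    then show "\<Phi> (y, k) \<in> H"
      using Y(1)[OF yk(1)] z(1) z(4) yk(2) unfolding H_def
      by (auto simp: \<Phi>_def configs_iff n_def)
  qed
  moreover have I: "card ?I = n + 2 * r" by simp
  have H: "finite H" "card H = N ^ (n + 2 * r)"
    using finite_supported_configs[of ?I] unfolding H_def N_def I by blast+
  ultimately have "card (?W \<times> {..K}) \<le> card H" using H(1) by (intro card_inj_on_le)
  moreover have "card (?W \<times> {..K}) = N ^ n * Suc K"
    by (simp add: card_cartesian_product card_PiE N_def)
  ultimately have "N ^ n * Suc K \<le> N ^ n * K" by (simp only: H(2) power_add K_def)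
  then show False using card_carrier_pos by (simp add: N_def)
qed

text \<open>By compactness there is an orphan \<open>w\<close>. On \<open>j\<close> consecutive
  blocks, images then take at most \<open>p ^ j\<close> values, for large \<open>j\<close> fewer
  than there are configurations supported on \<open>?I\<close>. Two of these share their image, and
  their quotient, shifted to start at 0, is as required.\<close>

lemma finite_kernel_config_if_not_surjective:
  assumes "\<not> ca_surjective (carrier G) r \<delta>"
  shows "\<exists>z m. finite_kernel_config z m"
proof -
  obtain k w where w: "w \<in> words k (carrier G)"
    and orphan: "\<And>x. x \<in> C \<Longrightarrow> map (\<lambda>i. F x (int i)) [0..<k] \<noteq> w"
    using ca_surjectiveI[OF fin local_rule] assms by metis
  define N where "N = card (carrier G)"
  have k: "k > 0"
    using orphan[of "\<lambda>_. \<one>"] w by (cases k) (auto simp: configs_iff words_def)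
  have words: "finite (words k (carrier G))" "card (words k (carrier G)) = N ^ k"
    using fin by (auto simp: words_def N_def finite_lists_length_eq card_lists_length_eq)
  have "N ^ k > 0" using card_carrier_pos by (simp add: N_def)
  then obtain p where p: "N ^ k = Suc p" using gr0_implies_Suc by blast
  \<comment> \<open>As \<open>Suc p = N ^ k\<close>, this amounts to
    \<open>p ^ j < N ^ (j * k - 2 * r)\<close>; the factor \<open>N ^ (2 * r)\<close> accounts for
    the cells left out of \<open>?I\<close>.\<close>
  obtain j where j: "j \<ge> 2 * r" "p ^ j * N ^ (2 * r) < Suc p ^ j"
    by (rule power_eventually_dominates)
  have jk: "2 * r \<le> j * k" using j(1) k by (metis le_trans mult_le_mono2 mult.right_neutral Suc_leI One_nat_def)
  \<comment> \<open>The margin of \<open>r\<close> cells at both ends makes the images trivial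
    outside the \<open>j\<close> blocks.\<close>
  let ?I = "{int r..<int (j * k) - int r}"
  define H where "H = {x \<in> C. \<forall>t. t \<notin> ?I \<longrightarrow> x t = \<one>}"
  \<comment> \<open>Moore--Myhill counting: images avoid \<open>w\<close> in each of the \<open>j\<close> blocks of length \<open>k\<close>.\<close>
  define \<Phi> where "\<Phi> x = restrict (\<lambda>b. map (\<lambda>i. F x (int (b * k + i))) [0..<k]) {..<j}" for x
  let ?T = "{..<j} \<rightarrow>\<^sub>E (words k (carrier G) - {w})"
  have "\<Phi> ` H \<subseteq> ?T"
  proof (clarify, unfold \<Phi>_def, rule restrict_PiE_iff[THEN iffD2], rule ballI)
    fix x b assume x: "x \<in> H"
    have "map (\<lambda>i. F (\<lambda>t. x (t + int (b * k))) (int i)) [0..<k] \<noteq> w"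
      using x by (intro orphan) (auto simp: H_def configs_iff)
    moreover have "F x q \<in> carrier G" for q using F_closed[of x] x by (auto simp: H_def configs_iff)
    ultimately show "map (\<lambda>i. F x (int (b * k + i))) [0..<k] \<in> words k (carrier G) - {w}"
      by (auto simp: words_def global_map_shift add_ac)
  qed
  moreover have "finite ?T" using words by (auto intro: finite_PiE)
  ultimately have "card (\<Phi> ` H) \<le> card ?T" by (intro card_mono)
  also have "card ?T = p ^ j" using words w p by (simp add: card_PiE)
  also have "p ^ j < N ^ (j * k - 2 * r)"
  proof -
    have "p ^ j * N ^ (2 * r) < N ^ (j * k - 2 * r) * N ^ (2 * r)"
      using j(2) jk by (simp flip: power_add p power_mult add: mult.commute)
    then show ?thesis by (rule mult_less_cancel2[THEN iffD1, THEN conjunct2])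
  qed
  also have "int (j * k) - int r - int r = int (j * k - 2 * r)" using jk by linarith
  then have "j * k - 2 * r = card ?I" by (simp only: card_atLeastLessThan_int nat_int)
  also have "N ^ card ?I = card H"
    unfolding H_def N_def by (rule finite_supported_configs(2)[symmetric]) simp
  finally have "\<not> inj_on \<Phi> H" by (rule pigeonhole)
  then obtain x y where xy: "x \<in> H" "y \<in> H" "\<Phi> x = \<Phi> y" "x \<noteq> y" by (auto simp: inj_on_def)
  have C: "x \<in> C" "y \<in> C" using xy by (auto simp: H_def)
  have "F x q = F y q" for q
  proof (cases "q \<in> {0..<int (j * k)}")
    case True
    define b i where "b = nat q div k" and "i = nat q mod k"
    have q: "q = int (b * k + i)" using True by (simp add: b_def i_def)
    have "i < k" using k by (simp add: i_def)
    have "nat q < j * k" using True unfolding atLeastLessThan_iff by linarith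
    then have "b < j" unfolding b_def by (rule less_mult_imp_div_less)
    with fun_cong[OF xy(3), of b] have "map (\<lambda>i. F x (int (b * k + i))) [0..<k] = map (\<lambda>i. F y (int (b * k + i))) [0..<k]"
      by (simp add: \<Phi>_def)
    with \<open>i < k\<close> show ?thesis unfolding q map_eq_conv by auto
  next
    case False
    then have "F x q = \<one>" "F y q = \<one>" using xy(1,2) by (auto simp: H_def intro!: F_eq_one)
    then show ?thesis by simp
  qed
  then have ker: "F (\<lambda>t. x t \<otimes> inv y t) q = \<one>" for q by (intro quotient_in_kernel C)
  define z where "z t = x t \<otimes> inv y t" for t
  have supp: "z t = \<one>" if "t \<notin> ?I" for t using that xy(1,2) by (auto simp: z_def H_def)
  from xy(4) obtain t0 where "x t0 \<noteq> y t0" by blast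
  then have "z t0 \<noteq> \<one>" using C by (simp add: z_def configs_iff inv_solve_right')
  with supp have "t0 \<ge> int r" by force
  \<comment> \<open>The support lies in \<open>?I\<close>, hence in nonnegative cells, so its
    leftmost cell is a least natural number.\<close>
  define s where "s = (LEAST s. z (int s) \<noteq> \<one>)"
  have "int (nat t0) = t0" using \<open>t0 \<ge> int r\<close> by simp
  with \<open>z t0 \<noteq> \<one>\<close> have s: "z (int s) \<noteq> \<one>"
    unfolding s_def by (metis (mono_tags, lifting) LeastI)
  have before_s: "z t = \<one>" if "t < int s" for t
  proof (cases "t < 0")
    case True
    then show ?thesis by (intro supp) auto
  next
    case False
    then have "nat t < s" "int (nat t) = t" using that by simp_all
    then show ?thesis using not_less_Least[of "nat t" "\<lambda>s. z (int s) \<noteq> \<one>"] unfolding s_def by metis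
  qed
  have "finite_kernel_config (\<lambda>t. z (t + int s)) (j * k)"
    unfolding finite_kernel_config_def global_map_shift
  proof (intro conjI allI impI)
    show "(\<lambda>t. z (t + int s)) \<in> C" using C by (simp add: z_def configs_iff)
    show "F z (p + int s) = \<one>" for p unfolding z_def by (rule ker)
    show "z (t + int s) = \<one>" if "t < 0 \<or> int (j * k) \<le> t" for t
      using that
    proof
      assume "t < 0"
      then show ?thesis by (intro before_s) simp
    next
      assume "int (j * k) \<le> t"
      then show ?thesis unfolding atLeastLessThan_iff by (intro supp) simp
    qed
  qed (use s in simp)
  then show ?thesis by blast
qed

lemma surjective_iff_bounded:
  "ca_surjective (carrier G) r \<delta> \<longleftrightarrow>
    \<not> (\<exists>z. finite_kernel_config z (Suc (card (carrier G) ^ (2 * r))))"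
  using not_surjective_if_finite_kernel_config finite_kernel_config_if_not_surjective
    shorten_finite_kernel_config by blast

end

section \<open>Evaluation on codes\<close>

lemma nth_concat_map_uniform:
  assumes "\<And>z. z \<in> set zs \<Longrightarrow> length (f z) = n" "i < length zs * n"
  shows "concat (map f zs) ! i = f (zs ! (i div n)) ! (i mod n)"
  using assms
proof (induction zs arbitrary: i)
  case (Cons z zs)
  show ?case
  proof (cases "i < n")
    case True
    then show ?thesis using Cons.prems by (simp add: nth_append)
  next
    case False
    then have "concat (map f zs) ! (i - n) = f (zs ! ((i - n) div n)) ! ((i - n) mod n)"
      using Cons.prems by (intro Cons.IH) auto
    moreover have "n > 0" using Cons.prems(2) by (cases n) auto
    then have "i div n = Suc ((i - n) div n)" "i mod n = (i - n) mod n"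
      using False Cons.prems by (simp_all add: le_div_geq le_mod_geq)
    ultimately show ?thesis using False Cons.prems by (simp add: nth_append)
  qed
qed simp

text \<open>\<open>List.n_lists\<close> runs the first letter through the inner list, so that letter
  is the least significant digit of the position.\<close>

lemma n_lists_nth:
  "i < n ^ k \<Longrightarrow> List.n_lists k [0..<n] ! i = map (\<lambda>j. i div n ^ j mod n) [0..<k]"
proof (induction k arbitrary: i)
  case (Suc k)
  have n: "n > 0" using Suc.prems by (cases n) auto
  have "i div n < n ^ k" using Suc.prems n by (simp add: less_mult_imp_div_less mult.commute)
  moreover have "List.n_lists (Suc k) [0..<n] ! i =
      map (\<lambda>y. y # List.n_lists k [0..<n] ! (i div n)) [0..<n] ! (i mod n)"
    unfolding List.n_lists.simps
    by (subst nth_concat_map_uniform[where n = n]) (use Suc.prems in \<open>auto simp: length_n_lists mult.commute\<close>)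
  ultimately have "List.n_lists (Suc k) [0..<n] ! i =
      i mod n # map (\<lambda>j. i div n div n ^ j mod n) [0..<k]"
    using Suc.IH n by simp
  also have "\<dots> = map (\<lambda>j. i div n ^ j mod n) [0..<Suc k]"
    by (simp add: map_upt_Suc div_mult2_eq del: upt_Suc)
  finally show ?case .
qed simp

lemma digit_of_mod_power:
  fixes a n :: nat
  assumes "j < k"
  shows "a mod n ^ k div n ^ j mod n = a div n ^ j mod n"
proof (cases "n = 0")
  case False
  have k: "n ^ k = n ^ j * n ^ (k - j)" using assms by (simp flip: power_add)
  have "a mod n ^ k div n ^ j = a div n ^ j mod n ^ (k - j)"
    unfolding k mod_mult2_eq using False by simp
  moreover have "n dvd n ^ (k - j)" using assms by (simp add: dvd_power)
  ultimately show ?thesis by (simp add: mod_mod_cancel)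
qed (use assms in \<open>simp add: power_0_left\<close>)

lemma number_with_digits:
  fixes n :: nat
  assumes "\<And>i. i < l \<Longrightarrow> w i < n"
  shows "\<exists>a<n ^ l. \<forall>i<l. a div n ^ i mod n = w i"
  using assms
proof (induction l arbitrary: w)
  case (Suc l)
  have "\<exists>a<n ^ l. \<forall>i<l. a div n ^ i mod n = w (Suc i)"
    by (rule Suc.IH) (use Suc.prems in simp)
  then obtain a where a: "a < n ^ l" "\<And>i. i < l \<Longrightarrow> a div n ^ i mod n = w (Suc i)" by blast
  have w0: "w 0 < n" using Suc.prems by simp
  have "w 0 + n * a < n * Suc a" using w0 by simp
  also have "\<dots> \<le> n * n ^ l" using a(1) by (intro mult_le_mono2) simp
  finally have "w 0 + n * a < n ^ Suc l" by simp
  moreover have "(w 0 + n * a) div n ^ i mod n = w i" if "i < Suc l" for i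
    using that w0 a(2) by (cases i) (simp_all add: div_mult2_eq)
  ultimately show ?case by blast
qed simp

lemma global_map_eq_upt:
  "global_map r \<delta> c p = \<delta> (map (\<lambda>j. c (p - int r + int j)) [0..<2 * r + 1])"
proof -
  have "map (\<lambda>j. c (p + j)) [- int r..int r] = map (\<lambda>j. c (p - int r + int j)) [0..<2 * r + 1]"
    by (intro nth_equalityI) (auto simp: nth_append algebra_simps simp del: upt_Suc)
  then show ?thesis by (simp only: global_map_def)
qed

text \<open>
  A word is represented by the number \<open>a\<close> whose base-\<open>n\<close> digits, least significant first, are
  its letters. The factor of length \<open>k\<close> at position \<open>i\<close> is then \<open>a div n ^ i mod n ^ k\<close>, which is
  also its index in \<open>List.n_lists k [0..<n]\<close>.
\<close>

definition kernel_word :: "nat \<Rightarrow> nat \<Rightarrow> nat \<Rightarrow> nat \<Rightarrow> nat \<Rightarrow> nat \<Rightarrow> bool" where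
  "kernel_word n r d e l a \<longleftrightarrow> (\<forall>i<l - 2 * r. code_nth d (a div n ^ i mod n ^ (2 * r + 1)) = e)"

text \<open>The identity is not listed in the code; \<open>e\<close> is recovered as the idempotent
  of the Cayley table. With \<open>m = n ^ (2 * r) + 1\<close>, the digits of \<open>a\<close> are
  the cells \<open>-2 * r, ..., m + 2 * r - 1\<close>: a support of extent \<open>m\<close> with
  \<open>2 * r\<close> identity cells on either side, so that every window meeting the support is
  tested.\<close>

definition nonsurjective_code :: "nat \<Rightarrow> nat \<Rightarrow> nat \<Rightarrow> nat \<Rightarrow> bool" where
  "nonsurjective_code n t r d \<longleftrightarrow>
    (\<exists>e<n. code_nth t (e * n + e) = e \<and>
      (\<exists>a<n ^ (Suc (n ^ (2 * r)) + 4 * r). kernel_word n r d e (Suc (n ^ (2 * r)) + 4 * r) a \<and>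
        (\<forall>i<2 * r. a div n ^ i mod n = e \<and> a div n ^ (Suc (n ^ (2 * r)) + 2 * r + i) mod n = e) \<and>
        \<not> a div n ^ (2 * r) mod n = e))"

text \<open>For the radius \<open>m = n ^ (2 * r) + r\<close> of the bounded criterion, the digits
  are the cells of \<open>[-(m + r), m + r]\<close>, which determine the image on
  \<open>[-m, m]\<close>. The middle digit is cell 0.\<close>

definition noninjective_code :: "nat \<Rightarrow> nat \<Rightarrow> nat \<Rightarrow> nat \<Rightarrow> bool" where
  "noninjective_code n t r d \<longleftrightarrow>
    (\<exists>e<n. code_nth t (e * n + e) = e \<and>
      (\<exists>a<n ^ (2 * (n ^ (2 * r) + 2 * r) + 1). kernel_word n r d e (2 * (n ^ (2 * r) + 2 * r) + 1) a \<and>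
        \<not> a div n ^ (n ^ (2 * r) + 2 * r) mod n = e))"

section \<open>Correctness of the coded conditions\<close>

locale coded_automaton = additive_automaton G r \<delta> for G :: "nat monoid" (structure) and r \<delta> +
  assumes carrier: "carrier G = {..<order G}"
begin

abbreviation "n \<equiv> order G"

abbreviation "table \<equiv> list_encode (map (\<lambda>(x, y). x \<otimes> y) (List.product [0..<n] [0..<n]))"

abbreviation "rule \<equiv> list_encode (map \<delta> (List.n_lists (2 * r + 1) [0..<n]))"

lemma configs_less: "c \<in> C \<longleftrightarrow> (\<forall>i. c i < n)"
  using carrier by (auto simp: configs_iff)

lemma one_less: "\<one> < n"
  using carrier one_closed by blast

text \<open>A group has no idempotent but its identity, and the row-by-row table has
  \<open>e \<otimes> e\<close> at index \<open>e * n + e\<close>.\<close>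

lemma idempotent_iff_one:
  assumes "e < n"
  shows "code_nth table (e * n + e) = e \<longleftrightarrow> e = \<one>"
proof -
  have "e * n + e < n * n"
  proof -
    have "e * n + e < Suc e * n" using assms by simp
    also have "\<dots> \<le> n * n" using assms by (intro mult_le_mono1) simp
    finally show ?thesis .
  qed
  then have "code_nth table (e * n + e) = e \<otimes> e"
    using assms by (simp add: code_nth_list_encode product_nth)
  moreover have "e \<in> carrier G" using assms carrier by blast
  ultimately show ?thesis by (simp add: r_cancel_one)
qed

lemma code_nth_rule:
  "code_nth rule (a div n ^ i mod n ^ (2 * r + 1)) =
    \<delta> (map (\<lambda>j. a div n ^ (i + j) mod n) [0..<2 * r + 1])"
proof -
  have less: "a div n ^ i mod n ^ (2 * r + 1) < n ^ (2 * r + 1)"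
    using one_less by simp
  then have "code_nth rule (a div n ^ i mod n ^ (2 * r + 1)) =
      \<delta> (map (\<lambda>j. a div n ^ i mod n ^ (2 * r + 1) div n ^ j mod n) [0..<2 * r + 1])"
    by (simp only: code_nth_list_encode length_map length_n_lists length_upt diff_zero nth_map n_lists_nth)
  also have "map (\<lambda>j. a div n ^ i mod n ^ (2 * r + 1) div n ^ j mod n) [0..<2 * r + 1] =
      map (\<lambda>j. a div n ^ (i + j) mod n) [0..<2 * r + 1]"
    by (intro map_cong refl) (auto simp: digit_of_mod_power power_add div_mult2_eq simp del: power_Suc)
  finally show ?thesis .
qed

text \<open>Digit \<open>i\<close> is cell \<open>i - s\<close>, so the window whose first digit is
  \<open>i\<close> is centred at \<open>i + r - s\<close>.\<close>

lemma kernel_word_iff: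
  assumes "\<And>i. i < l \<Longrightarrow> a div n ^ i mod n = z (int i - int s)"
  shows "kernel_word n r rule \<one> l a \<longleftrightarrow> (\<forall>i<l - 2 * r. F z (int i + int r - int s) = \<one>)"
proof -
  have "code_nth rule (a div n ^ i mod n ^ (2 * r + 1)) = F z (int i + int r - int s)" if "i < l - 2 * r" for i
  proof -
    have "map (\<lambda>j. a div n ^ (i + j) mod n) [0..<2 * r + 1] =
        map (\<lambda>j. z (int i + int r - int s - int r + int j)) [0..<2 * r + 1]"
    proof (intro map_cong refl)
      fix j assume "j \<in> set [0..<2 * r + 1]"
      then have "i + j < l" using that by auto
      then show "a div n ^ (i + j) mod n = z (int i + int r - int s - int r + int j)"
        by (simp add: assms algebra_simps)
    qed
    then show ?thesis by (simp only: code_nth_rule global_map_eq_upt)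
  qed
  then show ?thesis by (simp add: kernel_word_def)
qed

lemma config_of_number:
  "\<exists>z\<in>C. (\<forall>i<l. a div n ^ i mod n = z (int i - int s)) \<and>
    (\<forall>t. t < - int s \<or> int l - int s \<le> t \<longrightarrow> z t = \<one>)"
proof (intro bexI conjI allI impI)
  define z where "z t = (if t < - int s \<or> int l - int s \<le> t then \<one> else a div n ^ nat (t + int s) mod n)" for t
  show "z \<in> C" using one_less by (auto simp: configs_less z_def)
  show "a div n ^ i mod n = z (int i - int s)" if "i < l" for i using that by (simp add: z_def)
  show "z t = \<one>" if "t < - int s \<or> int l - int s \<le> t" for t using that by (simp add: z_def)
qed

lemma number_of_config:
  assumes "z \<in> C"
  shows "\<exists>a<n ^ l. \<forall>i<l. a div n ^ i mod n = z (int i - int s)"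
  using assms by (intro number_with_digits) (simp add: configs_less)

lemma nonsurjective_code_iff: "nonsurjective_code n table r rule \<longleftrightarrow> \<not> ca_surjective (carrier G) r \<delta>"
proof -
  define m where "m = Suc (n ^ (2 * r))"
  define l where "l = m + 4 * r"
  have code: "nonsurjective_code n table r rule \<longleftrightarrow>
      (\<exists>a<n ^ l. kernel_word n r rule \<one> l a \<and>
        (\<forall>i<2 * r. a div n ^ i mod n = \<one> \<and> a div n ^ (m + 2 * r + i) mod n = \<one>) \<and>
        a div n ^ (2 * r) mod n \<noteq> \<one>)"
    unfolding nonsurjective_code_def m_def[symmetric] l_def[symmetric]
    using one_less idempotent_iff_one by blast
  have "nonsurjective_code n table r rule \<longleftrightarrow> (\<exists>z. finite_kernel_config z m)"
  proof
    assume "nonsurjective_code n table r rule"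
    then obtain a where a: "kernel_word n r rule \<one> l a"
      "\<And>i. i < 2 * r \<Longrightarrow> a div n ^ i mod n = \<one>"
      "\<And>i. i < 2 * r \<Longrightarrow> a div n ^ (m + 2 * r + i) mod n = \<one>"
      "a div n ^ (2 * r) mod n \<noteq> \<one>"
      unfolding code by blast
    obtain z where z: "z \<in> C" "\<And>i. i < l \<Longrightarrow> a div n ^ i mod n = z (int i - int (2 * r))"
      "\<And>t. t < - int (2 * r) \<or> int l - int (2 * r) \<le> t \<Longrightarrow> z t = \<one>"
      using config_of_number[of l a "2 * r"] by blast
    have supp: "z t = \<one>" if t: "t < 0 \<or> int m \<le> t" for t
    proof -
      consider "t < - int (2 * r) \<or> int l - int (2 * r) \<le> t" | "- int (2 * r) \<le> t" "t < 0"
        | "int m \<le> t" "t < int l - int (2 * r)"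
        using t by (meson not_less)
      then show ?thesis
      proof cases
        case 1
        then show ?thesis by (rule z(3))
      next
        case 2
        then have "nat (t + int (2 * r)) < 2 * r" by linarith
        with a(2) z(2)[of "nat (t + int (2 * r))"] 2 show ?thesis by (simp add: l_def)
      next
        case 3
        then have "nat (t - int m) < 2 * r" by (simp add: l_def)
        with a(3) z(2)[of "m + 2 * r + nat (t - int m)"] 3 show ?thesis by (simp add: l_def)
      qed
    qed
    have ker: "\<And>i. i < l - 2 * r \<Longrightarrow> F z (int i + int r - int (2 * r)) = \<one>"
      using a(1) kernel_word_iff[OF z(2)] by blast
    have "F z p = \<one>" for p
    \<comment> \<open>The windows centred in this range are those meeting \<open>{0..<m}\<close>,
      and \<open>kernel_word\<close> tests exactly these.\<close>
    proof (cases "- int r \<le> p \<and> p < int m + int r")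
      case True
      then have "nat (p + int r) < l - 2 * r" by (simp add: l_def) linarith
      from ker[OF this] True show ?thesis by simp
    next
      case False
      then show ?thesis by (intro F_eq_one supp) linarith
    qed
    moreover have "z 0 \<noteq> \<one>" using z(2)[of "2 * r"] a(4) by (simp add: l_def m_def)
    ultimately show "\<exists>z. finite_kernel_config z m"
      using z(1) supp unfolding finite_kernel_config_def by blast
  next
    assume "\<exists>z. finite_kernel_config z m"
    then obtain z where z: "z \<in> C" "z 0 \<noteq> \<one>" "\<And>p. F z p = \<one>" "\<And>t. t < 0 \<or> int m \<le> t \<Longrightarrow> z t = \<one>"
      unfolding finite_kernel_config_def by blast
    obtain a where a: "a < n ^ l" "\<And>i. i < l \<Longrightarrow> a div n ^ i mod n = z (int i - int (2 * r))"
      using number_of_config[OF z(1)] by blast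
    have "kernel_word n r rule \<one> l a" using kernel_word_iff[OF a(2)] z(3) by blast
    moreover have "a div n ^ i mod n = \<one>" "a div n ^ (m + 2 * r + i) mod n = \<one>" if "i < 2 * r" for i
      using that a(2)[of i] a(2)[of "m + 2 * r + i"] z(4) by (simp_all add: l_def)
    moreover have "a div n ^ (2 * r) mod n \<noteq> \<one>" using a(2)[of "2 * r"] z(2) by (simp add: l_def m_def)
    ultimately show "nonsurjective_code n table r rule" unfolding code using a(1) by blast
  qed
  also have "\<dots> \<longleftrightarrow> \<not> ca_surjective (carrier G) r \<delta>"
    by (simp add: surjective_iff_bounded m_def order_def)
  finally show ?thesis .
qed

lemma noninjective_code_iff: "noninjective_code n table r rule \<longleftrightarrow> \<not> ca_injective (carrier G) r \<delta>"
proof -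
  define m where "m = n ^ (2 * r) + r"
  define l where "l = 2 * (m + r) + 1"
  have m: "n ^ (2 * r) + 2 * r = m + r" by (simp add: m_def)
  have code: "noninjective_code n table r rule \<longleftrightarrow>
      (\<exists>a<n ^ l. kernel_word n r rule \<one> l a \<and> a div n ^ (m + r) mod n \<noteq> \<one>)"
    unfolding noninjective_code_def m l_def[symmetric]
    using one_less idempotent_iff_one by blast
  have "noninjective_code n table r rule \<longleftrightarrow>
      (\<exists>z\<in>C. z 0 \<noteq> \<one> \<and> (\<forall>p. \<bar>p\<bar> \<le> int m \<longrightarrow> F z p = \<one>))"
  proof
    assume "noninjective_code n table r rule"
    then obtain a where a: "kernel_word n r rule \<one> l a" "a div n ^ (m + r) mod n \<noteq> \<one>"
      unfolding code by blast
    obtain z where z: "z \<in> C" "\<And>i. i < l \<Longrightarrow> a div n ^ i mod n = z (int i - int (m + r))"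
      using config_of_number[of l a "m + r"] by blast
    have ker: "\<And>i. i < l - 2 * r \<Longrightarrow> F z (int i + int r - int (m + r)) = \<one>"
      using a(1) kernel_word_iff[OF z(2)] by blast
    have "F z p = \<one>" if "\<bar>p\<bar> \<le> int m" for p
    proof -
      have "nat (p + int m) < l - 2 * r" "0 \<le> p + int m" using that by (simp_all add: l_def)
      with ker[of "nat (p + int m)"] show ?thesis by simp
    qed
    moreover have "z 0 \<noteq> \<one>" using z(2)[of "m + r"] a(2) by (simp add: l_def)
    ultimately show "\<exists>z\<in>C. z 0 \<noteq> \<one> \<and> (\<forall>p. \<bar>p\<bar> \<le> int m \<longrightarrow> F z p = \<one>)"
      using z(1) by blast
  next
    assume "\<exists>z\<in>C. z 0 \<noteq> \<one> \<and> (\<forall>p. \<bar>p\<bar> \<le> int m \<longrightarrow> F z p = \<one>)"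
    then obtain z where z: "z \<in> C" "z 0 \<noteq> \<one>" "\<And>p. \<bar>p\<bar> \<le> int m \<Longrightarrow> F z p = \<one>" by blast
    obtain a where a: "a < n ^ l" "\<And>i. i < l \<Longrightarrow> a div n ^ i mod n = z (int i - int (m + r))"
      using number_of_config[OF z(1)] by blast
    have "F z (int i + int r - int (m + r)) = \<one>" if "i < l - 2 * r" for i
      using that by (intro z(3)) (simp add: l_def)
    then have "kernel_word n r rule \<one> l a" using kernel_word_iff[OF a(2)] by blast
    moreover have "a div n ^ (m + r) mod n \<noteq> \<one>" using a(2)[of "m + r"] z(2) by (simp add: l_def)
    ultimately show "noninjective_code n table r rule" unfolding code using a(1) by blast
  qed
  also have "\<dots> \<longleftrightarrow> \<not> ca_injective (carrier G) r \<delta>"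
    by (simp only: injective_iff_bounded m_def order_def not_not)
  finally show ?thesis .
qed

end

section \<open>Decidability on the codes of instances\<close>

lemma decidable_on_additive_ca_instances:
  assumes rec: "total_recursive 1
      (\<lambda>xs. of_bool (Q (code_nth (hd xs) 0) (code_nth (hd xs) 1) (code_nth (hd xs) 2) (code_nth (hd xs) 3)))"
    and Q: "\<And>G r \<delta>. coded_automaton G r \<delta> \<Longrightarrow>
      Q (order G) (list_encode (map (\<lambda>(x, y). x \<otimes>\<^bsub>G\<^esub> y) (List.product [0..<order G] [0..<order G])))
        r (list_encode (map \<delta> (List.n_lists (2 * r + 1) [0..<order G]))) \<longleftrightarrow> \<not> P G r \<delta>"
  shows "decidable_on ca_code additive_ca_instances (\<lambda>(G, r, \<delta>). P G r \<delta>)"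
proof (rule decidable_on_if_total_recursive)
  show "total_recursive 1 (\<lambda>xs. of_bool (\<not> Q (code_nth (hd xs) 0) (code_nth (hd xs) 1) (code_nth (hd xs) 2) (code_nth (hd xs) 3)))"
    by (rule total_recursive_not[OF rec])
  fix x assume "x \<in> additive_ca_instances"
  then obtain G r \<delta> where x: "x = (G, r, \<delta>)" and G: "finite_abelian_group G" "additive_ca G r \<delta>"
    by (auto simp: additive_ca_instances_def)
  then have "finite (carrier G)" unfolding finite_abelian_group_def by (metis finite_lessThan)
  with G have "coded_automaton G r \<delta>"
    by (simp add: finite_abelian_group_def coded_automaton_def additive_automaton_def
      coded_automaton_axioms_def additive_automaton_axioms_def)
  from Q[OF this] show "(case x of (G, r, \<delta>) \<Rightarrow> P G r \<delta>) \<longleftrightarrow>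
      \<not> Q (code_nth (ca_code x) 0) (code_nth (ca_code x) 1) (code_nth (ca_code x) 2) (code_nth (ca_code x) 3)"
    unfolding x by (simp add: code_nth_list_encode del: list_encode.simps)
qed

theorem corollary2p26:
  shows "decidable_on ca_code additive_ca_instances (\<lambda>(G, r, \<delta>). ca_surjective (carrier G) r \<delta>) \<and>
         decidable_on ca_code additive_ca_instances (\<lambda>(G, r, \<delta>). ca_injective (carrier G) r \<delta>)"
proof
  show "decidable_on ca_code additive_ca_instances (\<lambda>(G, r, \<delta>). ca_surjective (carrier G) r \<delta>)"
  proof (rule decidable_on_additive_ca_instances)
    show "total_recursive 1 (\<lambda>xs. of_bool (nonsurjective_code
      (code_nth (hd xs) 0) (code_nth (hd xs) 1) (code_nth (hd xs) 2) (code_nth (hd xs) 3)))"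
      \<comment> \<open>What remains is built from bounded quantifiers, arithmetic and
        \<open>code_nth\<close>, so the collected rules assemble the program. The length 1 must
        appear as a successor to match them.\<close>
      unfolding nonsurjective_code_def kernel_word_def One_nat_def
      by (intro total_recursive_intros)
  qed (rule coded_automaton.nonsurjective_code_iff)
  show "decidable_on ca_code additive_ca_instances (\<lambda>(G, r, \<delta>). ca_injective (carrier G) r \<delta>)"
  proof (rule decidable_on_additive_ca_instances)
    show "total_recursive 1 (\<lambda>xs. of_bool (noninjective_code
      (code_nth (hd xs) 0) (code_nth (hd xs) 1) (code_nth (hd xs) 2) (code_nth (hd xs) 3)))"
      unfolding noninjective_code_def kernel_word_def One_nat_def
      by (intro total_recursive_intros)
  qed (rule coded_automaton.noninjective_code_iff)
qed

end
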